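(* There is an absolute constant $c>0$ such that for all integers $n\ge 2$ and $N\ge 2n$, every bounded-error quantum query algorithm that solves the one-to-one set equality problem for functions $a,b:[n]\to[N]$ must evaluate the functions (i.e. make queries to the oracles for $a$ and $b$) at least $c\,\sqrt[5]{\frac{n}{\ln n}}$ times. In short, the bounded-error quantum query complexity of the one-to-one set equality problem is $\Omega\!\left(\sqrt[5]{n/\ln n}\right)$.
   Context: Notation: $[n]=\{1,\dots,n\}$. One-to-one set equality problem: the input is a pair of functions $a,b:[n]\to[N]$, given by quantum oracles, with the promise that $a$ and $b$ are both injective ($a(i)\ne a(j)$ and $b(i)\neq b(j)$ for all $i\ne j$) and that, writing $A=\{a(1),\dots,a(n)\}$ and $B=\{b(1),\dots,b(n)\}$, either $A=B$ or $A\cap B=\emptyset$. The task is to decide which of the two cases holds. Quantum query model: a quantum algorithm making $T$ queries alternates $T$ applications of the oracle with input-independent unitaries, starting from a fixed state, and ends with a measurement giving the output. The pair $(a,b)$ is treated as a single input function on the disjoint union of the two domains, so one query evaluates $a$ or $b$ at one point (in superposition), e.g. via the unitary $|i,y,z\rangle\mapsto|i,(y+g(i))\bmod N,z\rangle$, where $g$ denotes the combined function. An algorithm solves a promise problem with bounded error if on every input satisfying the promise it outputs the correct answer with probability at least $2/3$. *)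

theory Defs
  imports
    Complex_Main
    "HOL-Library.FuncSet"
    "Jordan_Normal_Form.Schur_Decomposition"
begin

text \<open>
  Quantum query algorithms for functions \<open>g\<close> with domain \<open>{0..<m}\<close> and values in \<open>{1..N}\<close>.
  The state space has the basis states \<open>|i, y, z\<rangle>\<close> with \<open>i < m\<close> (query register), \<open>y < N\<close>
  (answer register, read modulo \<open>N\<close>) and \<open>z < W\<close> (workspace).  It is represented by complex
  vectors of dimension \<open>m * N * W\<close>, where \<open>|i, y, z\<rangle>\<close> is the unit vector with the index below.
\<close>

definition basis_index :: "nat \<Rightarrow> nat \<Rightarrow> nat \<Rightarrow> nat \<Rightarrow> nat \<Rightarrow> nat" where
  "basis_index N W i y z = (i * N + y) * W + z"

text \<open>
  The matrix of \<open>|i, y, z\<rangle> \<mapsto> |i, (y + g i) mod N, z\<rangle>\<close>; the \<open>let\<close> inverts \<^const>\<open>basis_index\<close>.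
\<close>

definition query_oracle :: "nat \<Rightarrow> nat \<Rightarrow> nat \<Rightarrow> (nat \<Rightarrow> nat) \<Rightarrow> complex mat" where
  "query_oracle m N W g = mat (m * N * W) (m * N * W) (\<lambda>(r, k).
     let i = k div (N * W); y = k div W mod N; z = k mod W
     in if r = basis_index N W i ((y + g i) mod N) z then 1 else 0)"

lemma basis_index_less:
  assumes "i < m" "y < N" "z < W"
  shows "basis_index N W i y z < m * N * W"
proof -
  have "i * N + y < m * N"
  proof -
    have "i * N + y < Suc i * N" using assms by simp
    also have "\<dots> \<le> m * N" using assms by (intro mult_right_mono) auto
    finally show ?thesis .
  qed
  hence "Suc (i * N + y) * W \<le> m * N * W" by (intro mult_right_mono) auto
  thus ?thesis unfolding basis_index_def using assms by simp
qed

lemma query_oracle_unit_vec: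
  assumes "i < m" "y < N" "z < W"
  shows "query_oracle m N W g *\<^sub>v unit_vec (m * N * W) (basis_index N W i y z) =
         unit_vec (m * N * W) (basis_index N W i ((y + g i) mod N) z)"
proof -
  let ?k = "basis_index N W i y z"
  have 1: "?k div W = i * N + y" and 2: "?k mod W = z"
    using assms by (auto simp: basis_index_def)
  have 3: "?k div (N * W) = i"
    using assms 1 by (simp add: div_mult2_eq mult.commute[of N W])
  have k: "?k < m * N * W" by (rule basis_index_less) (use assms in auto)
  have k': "basis_index N W i ((y + g i) mod N) z < m * N * W"
    by (rule basis_index_less) (use assms in auto)
  show ?thesis
    by (rule eq_vecI)
       (use k k' in \<open>auto simp: query_oracle_def Let_def 1 2 3 \<open>y < N\<close>\<close>)
qed

definition unitary_matrix :: "nat \<Rightarrow> complex mat \<Rightarrow> bool" where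
  "unitary_matrix d U \<longleftrightarrow> U \<in> carrier_mat d d \<and>
     mat_adjoint U * U = 1\<^sub>m d \<and> U * mat_adjoint U = 1\<^sub>m d"

text \<open>
  The algorithm applies \<open>gate 0\<close>, and then alternates the oracle with
  \<open>gate 1\<close>, \dots, \<open>gate queries\<close>.  At the end it measures in the computational basis and outputs
  \<open>verdict k\<close> when the outcome is the basis state with index \<open>k\<close>; more general
  projective measurements are covered by the choice of the last gate.
\<close>

record query_algorithm =
  queries :: nat
  workspace :: nat
  start :: "complex vec"
  gate :: "nat \<Rightarrow> complex mat"
  verdict :: "nat \<Rightarrow> bool"

definition is_query_algorithm :: "nat \<Rightarrow> nat \<Rightarrow> query_algorithm \<Rightarrow> bool" where
  "is_query_algorithm m N Q \<longleftrightarrow>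
     (let d = m * N * workspace Q in
       start Q \<in> carrier_vec d \<and> (\<Sum>k<d. (cmod (start Q $ k))\<^sup>2) = 1 \<and>
       (\<forall>t\<le>queries Q. unitary_matrix d (gate Q t)))"

primrec query_state ::
  "nat \<Rightarrow> nat \<Rightarrow> query_algorithm \<Rightarrow> (nat \<Rightarrow> nat) \<Rightarrow> nat \<Rightarrow> complex vec" where
  "query_state m N Q g 0 = gate Q 0 *\<^sub>v start Q"
| "query_state m N Q g (Suc t) =
     gate Q (Suc t) *\<^sub>v (query_oracle m N (workspace Q) g *\<^sub>v query_state m N Q g t)"

definition output_prob ::
  "nat \<Rightarrow> nat \<Rightarrow> query_algorithm \<Rightarrow> (nat \<Rightarrow> nat) \<Rightarrow> bool \<Rightarrow> real" where
  "output_prob m N Q g v =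
     (\<Sum>k | k < m * N * workspace Q \<and> verdict Q k = v.
       (cmod (query_state m N Q g (queries Q) $ k))\<^sup>2)"

text \<open>
  The disjoint union of the two domains \<open>{1..n}\<close> is laid out as \<open>{0..<2 * n}\<close>, first the points
  of \<open>a\<close>, then those of \<open>b\<close>.
\<close>

definition combined_input :: "nat \<Rightarrow> (nat \<Rightarrow> nat) \<Rightarrow> (nat \<Rightarrow> nat) \<Rightarrow> nat \<Rightarrow> nat" where
  "combined_input n a b i = (if i < n then a (i + 1) else b (i - n + 1))"

definition set_equality_promise :: "nat \<Rightarrow> nat \<Rightarrow> (nat \<Rightarrow> nat) \<Rightarrow> (nat \<Rightarrow> nat) \<Rightarrow> bool" where
  "set_equality_promise n N a b \<longleftrightarrow>
     a \<in> {1..n} \<rightarrow> {1..N} \<and> b \<in> {1..n} \<rightarrow> {1..N} \<and>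
     inj_on a {1..n} \<and> inj_on b {1..n} \<and>
     (a ` {1..n} = b ` {1..n} \<or> a ` {1..n} \<inter> b ` {1..n} = {})"

text \<open>The verdict \<^const>\<open>True\<close> stands for equality of the two image sets.\<close>

definition solves_set_equality :: "nat \<Rightarrow> nat \<Rightarrow> query_algorithm \<Rightarrow> bool" where
  "solves_set_equality n N Q \<longleftrightarrow>
     (\<forall>a b. set_equality_promise n N a b \<longrightarrow>
        output_prob (2 * n) N Q (combined_input n a b) (a ` {1..n} = b ` {1..n}) \<ge> 2 / 3)"

end

theory Submission
  imports Defs "HOL-Combinatorics.Permutations" "HOL-Computational_Algebra.Polynomial"
begin

text \<open>
  Read the input as one function \<open>g\<close> on \<open>m = 2n\<close> points. The acceptance probability of a \<open>T\<close>-query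
  algorithm is a sum of functions of \<open>g\<close> each reading at most \<open>d = 2T\<close> of its values, and it lies
  in \<open>[0, 1]\<close> for every \<open>g\<close>, whether or not \<open>g\<close> satisfies the promise.

  Following Zhandry, draw \<open>h\<close> from the \<open>m\<close> points to \<open>r\<close> points uniformly at random and label its
  classes injectively and at random by output values. The expected acceptance probability is \<open>p (1/r)\<close>
  for a polynomial \<open>p\<close> of degree at most \<open>d\<close>, and \<open>p 0\<close> belongs to a random injective \<open>g\<close>. As \<open>p\<close> is
  bounded at all the points \<open>1/r\<close>, interpolation gives \<open>|p 0 - p (1/r)| \<le> 16 d\<^sup>5 / r\<close>.

  With \<open>m = 2n\<close>, \<open>r = n\<close> this compares a random injective input (disjoint images) with \<open>\<sigma> \<circ> h\<close> for a random
  \<open>h\<close> of range \<open>n\<close>. With \<open>m = r = n\<close> it compares a random permutation of \<open>n\<close> points with a random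
  function, and so allows one to replace both halves of \<open>h\<close> by permutations, after which the two
  images are equal. The acceptance probabilities at the two ends differ by at least \<open>1/3\<close>,
  whence \<open>n \<le> 4608 T\<^sup>5\<close>.
\<close>

section \<open>Polynomials bounded at reciprocals of integers\<close>

text \<open>With \<open>J = e + k + 1\<close> each denominator factors as
  \<open>(J - i) * (J + i)\<close>, and the factors collect into factorials. Writing
  \<open>J\<close> in this way keeps it fixed in the induction: the step for \<open>Suc e\<close> at
  \<open>k\<close> uses the hypothesis at \<open>Suc k\<close>.\<close>

lemma prod_square_ratio_below:
  "(\<Prod>i\<in>{1..e}. (real i)\<^sup>2 / ((real (Suc (e + k)))\<^sup>2 - (real i)\<^sup>2)) =
     (fact e)\<^sup>2 * real (Suc (e + k)) * fact k / fact (2 * e + k + 1)"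
proof (induction e arbitrary: k)
  case (Suc e)
  let ?j = "real e + real k + 2"
  have j: "real (Suc (Suc e + k)) = ?j" "real (Suc (e + Suc k)) = ?j" by simp_all
  have factor: "?j\<^sup>2 - (real (Suc e))\<^sup>2 = (real k + 1) * (2 * real e + real k + 3)"
    by (simp add: power2_eq_square algebra_simps)
  have "(\<Prod>i\<in>{1..Suc e}. (real i)\<^sup>2 / (?j\<^sup>2 - (real i)\<^sup>2)) =
      (fact e)\<^sup>2 * ?j * fact (Suc k) / fact (2 * e + k + 2) *
      ((real (Suc e))\<^sup>2 / ((real k + 1) * (2 * real e + real k + 3)))"
    using Suc.IH[of "Suc k"] factor unfolding j
    by (simp add: prod.nat_ivl_Suc' del: fact_Suc of_nat_Suc)
  also have "\<dots> = (fact (Suc e))\<^sup>2 * ?j * fact k / fact (2 * Suc e + k + 1)"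
  proof -
    have "(fact (2 * Suc e + k + 1) :: real) = (2 * real e + real k + 3) * fact (2 * e + k + 2)"
      "(fact (Suc k) :: real) = (real k + 1) * fact k"
      "(fact (Suc e) :: real) = real (Suc e) * fact e"
      by (simp_all add: algebra_simps)
    note facts = this
    have "a\<^sup>2 * J * (p * b) / c * (m\<^sup>2 / (p * t)) = (m * a)\<^sup>2 * J * b / (t * c)"
      if "p \<noteq> 0" for a b c J m p t :: real
      using that by (simp add: power_mult_distrib mult_ac)
    moreover have "real k + 1 \<noteq> 0" by linarith
    ultimately show ?thesis unfolding facts by blast
  qed
  finally show ?case unfolding j .
qed simp

text \<open>For \<open>d = j + k\<close> this is the absolute Lagrange weight at 0 of the node j^2
  among 1, 4, ..., d^2; its value is twice binomial(2d, k) over binomial(2d, d). Induction on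
  \<open>k\<close> adds the nodes above \<open>j\<close>; those below are
  \<open>prod_square_ratio_below\<close>.\<close>

lemma prod_square_ratio:
  assumes "1 \<le> j"
  shows "(\<Prod>i\<in>{1..j + k} - {j}. (real i)\<^sup>2 / \<bar>(real i)\<^sup>2 - (real j)\<^sup>2\<bar>) =
     2 * (fact (j + k))\<^sup>2 / (fact k * fact (2 * j + k))"
proof (induction k)
  case 0
  obtain e where e: "j = Suc e" using assms by (cases j) auto
  have "{1..j + 0} - {j} = {1..e}" using e by auto
  moreover have "(\<Prod>i\<in>{1..e}. (real i)\<^sup>2 / \<bar>(real i)\<^sup>2 - (real j)\<^sup>2\<bar>) =
      (\<Prod>i\<in>{1..e}. (real i)\<^sup>2 / ((real (Suc (e + 0)))\<^sup>2 - (real i)\<^sup>2))"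
    by (intro prod.cong refl) (auto simp: e abs_if power_strict_mono not_less power_mono)
  moreover have "\<dots> = (fact e)\<^sup>2 * real j / fact (2 * e + 1)"
    unfolding prod_square_ratio_below by (simp add: e)
  moreover have "\<dots> = 2 * (fact j)\<^sup>2 / fact (2 * j)"
  proof -
    have "(fact (2 * j) :: real) = 2 * real j * fact (2 * e + 1)" "(fact j :: real) = real j * fact e"
      by (simp_all add: e algebra_simps)
    then show ?thesis using assms by (simp add: power2_eq_square)
  qed
  ultimately show ?case by simp
next
  case (Suc k)
  let ?J = "real j + real k + 1"
  have set: "{1..j + Suc k} - {j} = insert (Suc (j + k)) ({1..j + k} - {j})" by auto
  have factor: "\<bar>?J\<^sup>2 - (real j)\<^sup>2\<bar> = (real k + 1) * (2 * real j + real k + 1)"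
  proof -
    have "?J\<^sup>2 - (real j)\<^sup>2 = (real k + 1) * (2 * real j + real k + 1)"
      by (simp add: power2_eq_square algebra_simps)
    then show ?thesis by (simp add: abs_mult)
  qed
  have "(\<Prod>i\<in>{1..j + Suc k} - {j}. (real i)\<^sup>2 / \<bar>(real i)\<^sup>2 - (real j)\<^sup>2\<bar>) =
      ?J\<^sup>2 / ((real k + 1) * (2 * real j + real k + 1)) *
      (2 * (fact (j + k))\<^sup>2 / (fact k * fact (2 * j + k)))"
    unfolding set using Suc.IH factor by (simp add: add_ac)
  also have "\<dots> = 2 * (fact (j + Suc k))\<^sup>2 / (fact (Suc k) * fact (2 * j + Suc k))"
  proof -
    have "(fact (j + Suc k) :: real) = ?J * fact (j + k)"
      "(fact (Suc k) :: real) = (real k + 1) * fact k"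
      "(fact (2 * j + Suc k) :: real) = (2 * real j + real k + 1) * fact (2 * j + k)"
      by (simp_all add: algebra_simps)
    then show ?thesis by (simp only: power_mult_distrib times_divide_times_eq mult_ac)
  qed
  finally show ?case .
qed

text \<open>In row \<open>2 * (j + k)\<close> of Pascal's triangle, entry \<open>k\<close> is at
  most the central one.\<close>

lemma fact_square_le: "(fact (j + k) :: real)\<^sup>2 \<le> fact k * fact (2 * j + k)"
proof (induction j)
  case (Suc j)
  have "(fact (Suc j + k) :: real) = (real j + real k + 1) * fact (j + k)" by (simp add: algebra_simps)
  then have "(fact (Suc j + k) :: real)\<^sup>2 = (real j + real k + 1)\<^sup>2 * (fact (j + k))\<^sup>2"
    by (simp only: power_mult_distrib)
  also have "\<dots> \<le> ((2 * real j + real k + 1) * (2 * real j + real k + 2)) * (fact k * fact (2 * j + k))"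
    unfolding power2_eq_square[of "real j + real k + 1"]
    using Suc.IH by (intro mult_mono) (auto intro!: mult_mono)
  also have "\<dots> = fact k * fact (2 * Suc j + k)" by (simp add: algebra_simps)
  finally show ?case .
qed (simp add: power2_eq_square)

text \<open>The gain from quadratic spacing: for the nodes 1, ..., d the weights would be the
  binomial coefficients of row \<open>d\<close>, which are exponentially large.\<close>

lemma prod_square_ratio_le_2:
  assumes "1 \<le> j" "j \<le> d"
  shows "(\<Prod>i\<in>{1..d} - {j}. (real i)\<^sup>2 / \<bar>(real i)\<^sup>2 - (real j)\<^sup>2\<bar>) \<le> 2"
proof -
  obtain k where "d = j + k" using assms le_Suc_ex by blast
  then show ?thesis
    using prod_square_ratio[OF assms(1), of k] fact_square_le[of j k]
    by (simp add: pos_divide_le_eq)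
qed

section \<open>Interpolation at 0 from reciprocals of integers\<close>

text \<open>The Lagrange interpolant \<open>t\<close> and \<open>s\<close> agree at
  \<open>card J\<close> nodes and have smaller degree, so they coincide.\<close>

lemma lagrange_interpolation_at_0:
  fixes s :: "real poly"
  assumes "inj_on x J" "finite J" "degree s < card J"
  shows "poly s 0 = (\<Sum>j\<in>J. poly s (x j) * (\<Prod>i\<in>J - {j}. - x i / (x j - x i)))"
proof -
  define L where "L j = (\<Prod>i\<in>J - {j}. smult (1 / (x j - x i)) [:- x i, 1:])" for j
  define t where "t = (\<Sum>j\<in>J. smult (poly s (x j)) (L j))"
  have Lval: "poly (L j) y = (\<Prod>i\<in>J - {j}. (y - x i) / (x j - x i))" for j y
    by (simp add: L_def poly_prod flip: diff_divide_distrib)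
  have "degree (L j) \<le> card J - 1" if "j \<in> J" for j
  proof -
    have "degree (L j) \<le> sum (degree \<circ> (\<lambda>i. smult (1 / (x j - x i)) [:- x i, 1:])) (J - {j})"
      unfolding L_def by (rule degree_prod_sum_le) (use assms in auto)
    also have "\<dots> \<le> (\<Sum>i\<in>J - {j}. 1)" by (intro sum_mono) auto
    also have "\<dots> = card J - 1" using that assms by simp
    finally show ?thesis .
  qed
  then have "degree t \<le> card J - 1"
    unfolding t_def by (intro degree_sum_le) (use assms in \<open>auto intro: order_trans[OF degree_smult_le]\<close>)
  then have degt: "degree t < card J" using assms(3) by linarith
  have "poly s y = poly t y" if "y \<in> x ` J" for y
  proof -
    obtain k where k: "k \<in> J" "y = x k" using \<open>y \<in> x ` J\<close> by blast
    have "poly (L j) (x k) = (if j = k then 1 else 0)" if "j \<in> J" for j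
    proof (cases "j = k")
      case True
      have "x k \<noteq> x i" if "i \<in> J - {k}" for i
        using that assms(1) k by (auto dest: inj_onD)
      then show ?thesis using True by (auto simp: Lval intro!: prod.neutral)
    next
      case False
      then have "k \<in> J - {j}" using k by auto
      then show ?thesis using False assms(2) unfolding Lval by (simp add: prod_zero) force
    qed
    then have "poly t (x k) = (\<Sum>j\<in>J. poly s (x j) * (if j = k then 1 else 0))"
      unfolding t_def by (simp add: poly_sum)
    also have "\<dots> = poly s (x k)" using assms(2) k by (simp add: if_distrib[of "(*) _"] cong: if_cong)
    finally show ?thesis using k by simp
  qed
  moreover have "card (x ` J) = card J" using assms(1) by (rule card_image)
  ultimately have "s = t" using degt assms(3) by (intro poly_eqI_degree[of "x ` J"]) auto
  then have "poly s 0 = poly t 0" by simp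
  then show ?thesis by (simp add: t_def poly_sum Lval)
qed

text \<open>
  The nodes \<open>1 / r j\<close> approximate the points \<open>j\<^sup>2 / K\<close>, which near \<open>0\<close> are spaced like the Chebyshev
  nodes; \<open>K = 2 d\<^sup>4\<close> is large enough for the rounding to be harmless.
\<close>

lemma rounded_node_gap:
  fixes d :: nat
  defines "r \<equiv> \<lambda>j. 2 * d ^ 4 div j ^ 2"
  assumes "1 \<le> i" "i < j" "j \<le> d"
  shows "real (r i) - real (r j) \<ge>
    2 * real d ^ 4 * ((real j)\<^sup>2 - (real i)\<^sup>2) / ((real i)\<^sup>2 * (real j)\<^sup>2) * (1 - 1 / (2 * real d))"
proof -
  let ?K = "2 * real d ^ 4" and ?g = "((real j)\<^sup>2 - (real i)\<^sup>2) / ((real i)\<^sup>2 * (real j)\<^sup>2)"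
  have pos: "real i > 0" "real j > 0" "real d > 0" using assms by auto
  \<comment> \<open>Rounding down lowers the value at \<open>i\<close> by less than 1 and does not
    raise the one at \<open>j\<close>, so the gap shrinks by less than 1.\<close>
  have Ki: "?K / (real i)\<^sup>2 < real (r i) + 1"
    using floor_divide_of_nat_eq[of "2 * d ^ 4" "i ^ 2", where 'a = real]
      floor_correct[of "?K / (real i)\<^sup>2"] by (simp add: r_def)
  have Kj: "real (r j) \<le> ?K / (real j)\<^sup>2"
    using of_nat_div_le_of_nat[of "2 * d ^ 4" "j ^ 2"] by (simp add: r_def)
  \<comment> \<open>The unrounded gap \<open>?K * ?g\<close> is at least \<open>2 * d\<close>, so a
    loss of 1 is at most the fraction \<open>1 / (2 * d)\<close> of it.\<close>
  have "(real i)\<^sup>2 * (real j)\<^sup>2 = ((real i)\<^sup>2 * real j) * real j" by (simp add: power2_eq_square)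
  also have "\<dots> \<le> ((real d)\<^sup>2 * real d) * ((real j)\<^sup>2 - (real i)\<^sup>2)"
  proof (intro mult_mono power_mono)
    have "real j * 1 \<le> (real j + real i) * (real j - real i)"
      using assms by (intro mult_mono) auto
    then show "real j \<le> (real j)\<^sup>2 - (real i)\<^sup>2" by (simp add: power2_eq_square algebra_simps)
  qed (use assms in auto)
  also have "(real d)\<^sup>2 * real d = ?K * (1 / (2 * real d))"
    using pos by (simp add: divide_simps power2_eq_square power4_eq_xxxx)
  finally have "1 \<le> ?K * ?g * (1 / (2 * real d))"
    using pos by (simp add: divide_simps mult_ac)
  moreover have "?K / (real i)\<^sup>2 - ?K / (real j)\<^sup>2 = ?K * ?g"
    using pos by (simp add: divide_simps algebra_simps)
  ultimately have "real (r i) - real (r j) \<ge> ?K * ?g - ?K * ?g * (1 / (2 * real d))"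
    using Ki Kj by linarith
  then show ?thesis by (simp only: right_diff_distrib mult_1_right times_divide_eq_right)
qed

text \<open>The quotient on the left is the absolute Lagrange factor at 0 for nodes
  \<open>1 / r i\<close>. Rounding can only lower its numerator, and by
  \<open>rounded_node_gap\<close> it shrinks the denominator by a factor no smaller than
  \<open>1 - 1 / (2 * d)\<close>.\<close>

lemma rounded_node_ratio:
  fixes d :: nat
  defines "r \<equiv> \<lambda>j. 2 * d ^ 4 div j ^ 2"
  assumes "i \<in> {1..d}" "j \<in> {1..d}" "i \<noteq> j"
  shows "r i \<noteq> r j"
    and "real (r j) / \<bar>real (r j) - real (r i)\<bar> \<le>
      (real i)\<^sup>2 / \<bar>(real i)\<^sup>2 - (real j)\<^sup>2\<bar> / (1 - 1 / (2 * real d))"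
proof -
  let ?K = "2 * real d ^ 4" and ?e = "1 - 1 / (2 * real d)"
  let ?D = "\<bar>(real i)\<^sup>2 - (real j)\<^sup>2\<bar>"
  have pos: "real i > 0" "real j > 0" "real d \<ge> 1" using assms by auto
  then have e: "?e > 0" by (simp add: divide_simps)
  have D: "?D > 0" using assms by (simp add: power2_eq_iff)
  have gap: "\<bar>real (r j) - real (r i)\<bar> \<ge> ?K * ?D / ((real i)\<^sup>2 * (real j)\<^sup>2) * ?e"
  proof (cases "i < j")
    case True
    then have "?D = (real j)\<^sup>2 - (real i)\<^sup>2" by (simp add: abs_if power_strict_mono)
    then show ?thesis using rounded_node_gap[of i j d] True assms(2-4)
      unfolding r_def by auto
  next
    case False
    then have "j < i" using assms by auto
    then have "?D = (real i)\<^sup>2 - (real j)\<^sup>2" by (simp add: abs_if power_mono not_less)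
    then show ?thesis using rounded_node_gap[of j i d] \<open>j < i\<close> assms(2-4)
      unfolding r_def by (auto simp: mult.commute)
  qed
  have gpos: "?K * ?D / ((real i)\<^sup>2 * (real j)\<^sup>2) * ?e > 0"
    using pos e D by (intro mult_pos_pos divide_pos_pos) auto
  show "r i \<noteq> r j" using gap gpos by auto
  have "real (r j) / \<bar>real (r j) - real (r i)\<bar> \<le>
      (?K / (real j)\<^sup>2) / (?K * ?D / ((real i)\<^sup>2 * (real j)\<^sup>2) * ?e)"
    using gap gpos of_nat_div_le_of_nat[of "2 * d ^ 4" "j ^ 2"]
    by (intro frac_le) (auto simp: r_def)
  also have "\<dots> = (real i)\<^sup>2 / ?D / ?e"
    using pos e D by (simp add: divide_simps)
  finally show "real (r j) / \<bar>real (r j) - real (r i)\<bar> \<le> (real i)\<^sup>2 / ?D / ?e" .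
qed

text \<open>By Bernoulli's inequality the \<open>d - 1\<close> rounding losses multiply to at least
  1/2, so they at most double the bound 2 for exact squares.\<close>

lemma rounded_node_prod_le:
  fixes d :: nat
  defines "r \<equiv> \<lambda>j. 2 * d ^ 4 div j ^ 2"
  assumes "j \<in> {1..d}"
  shows "(\<Prod>i\<in>{1..d} - {j}. real (r j) / \<bar>real (r j) - real (r i)\<bar>) \<le> 4"
proof -
  let ?e = "1 - 1 / (2 * real d)"
  let ?P = "\<Prod>i\<in>{1..d} - {j}. (real i)\<^sup>2 / \<bar>(real i)\<^sup>2 - (real j)\<^sup>2\<bar>"
  have d: "real d \<ge> 1" using assms by auto
  have "1 + real (d - 1) * (- (1 / (2 * real d))) \<le> (1 + - (1 / (2 * real d))) ^ (d - 1)"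
    using d by (intro Bernoulli_inequality) (simp add: divide_simps)
  moreover have "1 / 2 \<le> 1 + real (d - 1) * (- (1 / (2 * real d)))"
    using d by (simp add: divide_simps of_nat_diff)
  ultimately have e: "1 / 2 \<le> ?e ^ (d - 1)" by simp
  have "(\<Prod>i\<in>{1..d} - {j}. real (r j) / \<bar>real (r j) - real (r i)\<bar>) \<le>
      (\<Prod>i\<in>{1..d} - {j}. (real i)\<^sup>2 / \<bar>(real i)\<^sup>2 - (real j)\<^sup>2\<bar> / ?e)"
    using assms rounded_node_ratio(2)[of _ d j] by (intro prod_mono) auto
  also have "\<dots> = ?P / ?e ^ (d - 1)"
    using assms by (simp only: prod_dividef prod_constant) simp
  also have "\<dots> \<le> 2 / (1 / 2)"
    using e prod_square_ratio_le_2[of j d] assms by (intro frac_le) (auto intro!: prod_nonneg)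
  finally show ?thesis by simp
qed

text \<open>If \<open>d = 0\<close> the polynomial is constant, and if \<open>n < 4 * d ^ 4\<close>
  the bound exceeds 1. Otherwise the difference quotient \<open>s\<close> of \<open>q\<close> at
  \<open>1 / n\<close> is interpolated at 0 from \<open>d\<close> nodes, where it is at most
  \<open>4 * d ^ 4\<close> with weights at most 4.\<close>

lemma poly_reciprocal_difference:
  fixes q :: "real poly"
  assumes deg: "degree q \<le> d"
    and q0: "poly q 0 \<in> {0..1}"
    and q1: "\<And>r. r \<ge> 1 \<Longrightarrow> poly q (1 / real r) \<in> {0..1}"
    and n: "n \<ge> 1"
  shows "\<bar>poly q 0 - poly q (1 / real n)\<bar> \<le> 16 * real d ^ 5 / real n"
proof (cases "d = 0 \<or> n < 4 * d ^ 4")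
  case True
  show ?thesis
  proof (cases "d = 0")
    case True
    then obtain a where "q = [:a:]" using deg degree_eq_zeroE by auto
    then show ?thesis by simp
  next
    case False
    have "real n \<le> real (4 * d ^ 4)" using \<open>d = 0 \<or> _\<close> False by (intro of_nat_mono) auto
    also have "\<dots> \<le> 16 * real d ^ 4 * real d"
      using False by (simp add: mult_le_cancel_left1)
    finally have "1 \<le> 16 * real d ^ 5 / real n"
      using n by (simp add: divide_simps eval_nat_numeral mult_ac)
    then show ?thesis using q0 q1[OF n] by auto
  qed
next
  case False
  define r where "r j = 2 * d ^ 4 div j ^ 2" for j :: nat
  define x where "x j = 1 / real (r j)" for j
  define x0 where "x0 = 1 / real n"
  have d: "d \<ge> 1" and nK: "n \<ge> 4 * d ^ 4" using False by auto
  have x0: "x0 > 0" using n by (simp add: x0_def)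
  \<comment> \<open>Dividing out the zero at \<open>x0\<close> makes the difference at 0 equal to
    \<open>x0\<close> times \<open>s\<close> at 0 up to sign, so a bound on \<open>s\<close> at 0
    independent of \<open>n\<close> suffices.\<close>
  obtain s where s: "q - [:poly q x0:] = [:- x0, 1:] * s"
    using poly_eq_0_iff_dvd[of "q - [:poly q x0:]" x0] by (auto elim: dvdE)
  have sval: "poly q y - poly q x0 = (y - x0) * poly s y" for y
    using arg_cong[OF s, of "\<lambda>p. poly p y"] by (simp add: algebra_simps)
  have "degree s < d"
  proof (cases "s = 0")
    case False
    have "degree (q - [:poly q x0:]) \<le> d" using deg by (intro degree_diff_le) auto
    moreover have "degree ([:- x0, 1:] * s) = 1 + degree s"
      using False by (subst degree_mult_eq) auto
    ultimately show ?thesis unfolding s by simp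
  qed (use d in auto)
  have rpos: "r j \<ge> 1" if "j \<in> {1..d}" for j
  proof -
    have "j ^ 2 \<le> d ^ 2" using that by (intro power_mono) auto
    also have "\<dots> \<le> d ^ 4" using d by (intro power_increasing) auto
    finally have "j ^ 2 \<le> 2 * d ^ 4" by simp
    then show ?thesis using that by (simp add: r_def div_greater_zero_iff Suc_le_eq)
  qed
  have inj: "inj_on x {1..d}"
  proof (rule inj_onI)
    fix i j assume ij: "i \<in> {1..d}" "j \<in> {1..d}" "x i = x j"
    then have "r i = r j" by (simp add: x_def)
    then show "i = j" using rounded_node_ratio(1)[of i d j] ij by (auto simp: r_def)
  qed
  have summand: "\<bar>poly s (x j) * (\<Prod>i\<in>{1..d} - {j}. - x i / (x j - x i))\<bar> \<le> 16 * real d ^ 4"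
    if j: "j \<in> {1..d}" for j
  proof -
    have rK: "real (r j) \<le> 2 * real d ^ 4"
      using of_nat_mono[OF div_le_dividend[of "2 * d ^ 4" "j\<^sup>2"], where 'a = real] by (simp add: r_def)
    have "2 * real (r j) \<le> real n" using rK of_nat_mono[OF nK, where 'a = real] by simp
    \<comment> \<open>Since \<open>n \<ge> 2 * r j\<close>, every node is at least
      \<open>2 * x0\<close>; its distance from \<open>x0\<close> is at least half the node.\<close>
    then have gap: "x j - x0 \<ge> 1 / (2 * real (r j))"
      using rpos[OF j] n by (simp add: x_def x0_def divide_simps)
    moreover have "1 / (2 * real (r j)) > 0" using rpos[OF j] by simp
    ultimately have gap_pos: "x j - x0 > 0" by linarith
    have "(x j - x0) * \<bar>poly s (x j)\<bar> = \<bar>poly q (x j) - poly q x0\<bar>"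
      using gap_pos by (subst sval) (simp add: abs_mult)
    also have "\<dots> \<le> 1" using q1[OF rpos[OF j]] q1[OF n] by (auto simp: x_def x0_def abs_le_iff)
    finally have "1 / (2 * real (r j)) * \<bar>poly s (x j)\<bar> \<le> 1"
      using gap by (meson abs_ge_zero mult_right_mono order_trans)
    then have "\<bar>poly s (x j)\<bar> \<le> 2 * real (r j)" using rpos[OF j] by (simp add: divide_simps)
    then have sb: "\<bar>poly s (x j)\<bar> \<le> 4 * real d ^ 4" using rK by linarith
    have "\<bar>\<Prod>i\<in>{1..d} - {j}. - x i / (x j - x i)\<bar> =
        (\<Prod>i\<in>{1..d} - {j}. real (r j) / \<bar>real (r j) - real (r i)\<bar>)"
      unfolding abs_prod
    proof (intro prod.cong refl)
      fix i assume i: "i \<in> {1..d} - {j}"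
      have "real (r i) > 0" "real (r j) > 0" using rpos i j by fastforce+
      moreover have "r i \<noteq> r j" using rounded_node_ratio(1)[of i d j] i j by (auto simp: r_def)
      ultimately show "\<bar>- x i / (x j - x i)\<bar> = real (r j) / \<bar>real (r j) - real (r i)\<bar>"
        unfolding x_def by (simp add: abs_divide field_simps abs_minus_commute) 
    qed
    also have "\<dots> \<le> 4" using rounded_node_prod_le[OF j] by (simp add: r_def)
    finally have "\<bar>poly s (x j)\<bar> * \<bar>\<Prod>i\<in>{1..d} - {j}. - x i / (x j - x i)\<bar> \<le> (4 * real d ^ 4) * 4"
      using sb by (intro mult_mono) auto
    then show ?thesis by (simp add: abs_mult)
  qed
  have "\<bar>poly s 0\<bar> \<le> (\<Sum>j\<in>{1..d}. 16 * real d ^ 4)"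
  proof -
    have "degree s < card {1..d}" using \<open>degree s < d\<close> by simp
    note lagrange_interpolation_at_0[OF inj finite_atLeastAtMost this]
    then show ?thesis
      by (simp only:) (intro order_trans[OF sum_abs] sum_mono summand)
  qed
  also have "\<dots> = 16 * real d ^ 5" by (simp add: eval_nat_numeral)
  finally have "x0 * \<bar>poly s 0\<bar> \<le> x0 * (16 * real d ^ 5)" using x0 by (intro mult_left_mono) auto
  moreover have "\<bar>poly q 0 - poly q x0\<bar> = x0 * \<bar>poly s 0\<bar>"
    using sval[of 0] x0 by (simp add: abs_mult)
  ultimately show ?thesis by (simp add: x0_def mult.commute)
qed

section \<open>Averages\<close>

text \<open>Expectation under the uniform distribution on \<open>A\<close>; it is 0 when
  \<open>A\<close> is empty or infinite.\<close>

definition avg :: "'b set \<Rightarrow> ('b \<Rightarrow> real) \<Rightarrow> real" where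
  "avg A f = (\<Sum>x\<in>A. f x) / card A"

lemma avg_cong: "(\<And>x. x \<in> A \<Longrightarrow> f x = g x) \<Longrightarrow> avg A f = avg A g"
  unfolding avg_def by (simp cong: sum.cong)

lemma avg_const:
  assumes "finite A" "A \<noteq> {}"
  shows "avg A (\<lambda>_. c) = c"
  using assms by (simp add: avg_def)

lemma avg_mono:
  assumes "\<And>x. x \<in> A \<Longrightarrow> f x \<le> g x"
  shows "avg A f \<le> avg A g"
  using assms unfolding avg_def by (intro divide_right_mono sum_mono) auto

lemma avg_swap: "avg A (\<lambda>x. avg B (f x)) = avg B (\<lambda>y. avg A (\<lambda>x. f x y))"
  unfolding avg_def by (simp add: sum_divide_distrib[symmetric] sum.swap[of _ A B] mult.commute)

lemma abs_avg_diff_le: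
  assumes "\<And>x. x \<in> A \<Longrightarrow> \<bar>f x - g x\<bar> \<le> e" "finite A" "A \<noteq> {}"
  shows "\<bar>avg A f - avg A g\<bar> \<le> e"
proof -
  have "avg A f \<le> avg A (\<lambda>x. g x + e)" "avg A g \<le> avg A (\<lambda>x. f x + e)"
    using assms(1) by (force intro!: avg_mono simp: abs_le_iff algebra_simps)+
  moreover have "avg A (\<lambda>x. h x + e) = avg A h + e" for h
    using assms(2,3) by (simp add: avg_def sum.distrib add_divide_distrib)
  ultimately show ?thesis by simp
qed

lemma avg_bounds:
  assumes "\<And>x. x \<in> A \<Longrightarrow> f x \<in> {a..b}" "finite A" "A \<noteq> {}"
  shows "avg A f \<in> {a..b}"
  using avg_mono[of A "\<lambda>_. a" f] avg_mono[of A f "\<lambda>_. b"] assms by (auto simp: avg_const)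

lemma avg_reindex_bij:
  assumes "bij_betw t A B"
  shows "avg A (\<lambda>x. f (t x)) = avg B f"
  unfolding avg_def using sum.reindex_bij_betw[OF assms, of f] bij_betw_same_card[OF assms] by simp

abbreviation glue :: "nat \<Rightarrow> (nat \<Rightarrow> 'b) \<Rightarrow> (nat \<Rightarrow> 'b) \<Rightarrow> nat \<Rightarrow> 'b" where
  "glue n g h \<equiv> \<lambda>x. if x < n then g x else h (x - n)"

text \<open>A uniformly random function on \<open>n + m\<close> points consists of two independent
  uniformly random functions, on the first \<open>n\<close> and the last \<open>m\<close>
  points.\<close>

lemma avg_PiE_add:
  fixes R :: "'b set"
  shows "avg ({..<n + m} \<rightarrow>\<^sub>E R) f =
     avg ({..<n} \<rightarrow>\<^sub>E R) (\<lambda>g. avg ({..<m} \<rightarrow>\<^sub>E R) (\<lambda>h. f (restrict (glue n g h) {..<n + m})))"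
proof -
  define A where "A = ({..<n} \<rightarrow>\<^sub>E R)"
  define B where "B = ({..<m} \<rightarrow>\<^sub>E R)"
  define t :: "(nat \<Rightarrow> 'b) \<times> (nat \<Rightarrow> 'b) \<Rightarrow> nat \<Rightarrow> 'b"
    where "t = (\<lambda>p. restrict (glue n (fst p) (snd p)) {..<n + m})"
  define u where "u k = (restrict k {..<n}, restrict (\<lambda>x. k (x + n)) {..<m})" for k :: "nat \<Rightarrow> 'b"
  have "bij_betw t (A \<times> B) ({..<n + m} \<rightarrow>\<^sub>E R)"
  proof (rule bij_betwI[of _ _ _ u])
    show "t (u k) = k" if "k \<in> {..<n + m} \<rightarrow>\<^sub>E R" for k
    proof
      fix x
      consider "x < n" | y where "x = n + y" "y < m" | "x \<ge> n + m"
        by (metis add_less_cancel_left le_Suc_ex not_less)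
      then show "t (u k) x = k x"
        using that by cases (auto simp: t_def u_def add.commute PiE_def extensional_def)
    qed
    show "u \<in> ({..<n + m} \<rightarrow>\<^sub>E R) \<rightarrow> A \<times> B"
      by (auto simp: u_def A_def B_def PiE_def Pi_def)
    show "t \<in> A \<times> B \<rightarrow> ({..<n + m} \<rightarrow>\<^sub>E R)"
      by (auto simp: t_def A_def B_def PiE_def Pi_def less_diff_conv2 not_less)
    show "u (t p) = p" if "p \<in> A \<times> B" for p
      using that by (cases p) (auto simp: t_def u_def A_def B_def PiE_def extensional_def restrict_def fun_eq_iff)
  qed
  then have "avg (A \<times> B) (\<lambda>p. f (t p)) = avg ({..<n + m} \<rightarrow>\<^sub>E R) f"
    by (rule avg_reindex_bij)
  moreover have "avg (A \<times> B) (\<lambda>p. f (t p)) =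
      avg A (\<lambda>g. avg B (\<lambda>h. f (restrict (glue n g h) {..<n + m})))"
    unfolding t_def
    by (simp add: avg_def sum.cartesian_product case_prod_beta card_cartesian_product
      sum_divide_distrib[symmetric] mult.commute)
  ultimately show ?thesis by (simp only: A_def B_def)
qed

section \<open>Sums of juntas\<close>

text \<open>
  After \<open>T\<close> queries the amplitudes are sums of functions each reading at most \<open>T\<close> values of the input:
  this is the polynomial method, with monomials replaced by juntas.
\<close>

inductive junta_sum :: "'x set \<Rightarrow> nat \<Rightarrow> (('x \<Rightarrow> 'y) \<Rightarrow> 'a::comm_monoid_add) \<Rightarrow> bool"
  for X d where
  junta: "finite S \<Longrightarrow> S \<subseteq> X \<Longrightarrow> card S \<le> d \<Longrightarrow>
    (\<And>g g'. (\<And>x. x \<in> S \<Longrightarrow> g x = g' x) \<Longrightarrow> F g = F g') \<Longrightarrow> junta_sum X d F"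
| add: "junta_sum X d F \<Longrightarrow> junta_sum X d G \<Longrightarrow> junta_sum X d (\<lambda>g. F g + G g)"

lemma junta_sum_const: "junta_sum X d (\<lambda>_. c)"
  by (rule junta[of "{}"]) auto

lemma junta_sum_sum:
  "(\<And>i. i \<in> I \<Longrightarrow> junta_sum X d (F i)) \<Longrightarrow> junta_sum X d (\<lambda>g. \<Sum>i\<in>I. F i g)"
  by (induction I rule: infinite_finite_induct) (auto intro: junta_sum_const junta_sum.add)

text \<open>Lets the input be altered outside \<open>X\<close>, in particular by
  \<open>restrict\<close>.\<close>

lemma junta_sum_cong:
  "junta_sum X d F \<Longrightarrow> (\<And>x. x \<in> X \<Longrightarrow> g x = g' x) \<Longrightarrow> F g = F g'"
proof (induction rule: junta_sum.induct)
  case (junta S F)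
  show ?case by (rule junta.hyps(4)) (use junta in blast)
qed simp

text \<open>Serves \<open>Re\<close> and \<open>Im\<close>, to pass from complex amplitudes to real
  functions.\<close>

lemma junta_sum_additive_map:
  assumes "junta_sum X d F" "\<And>a b. \<phi> (a + b) = \<phi> a + \<phi> b"
  shows "junta_sum X d (\<lambda>g. \<phi> (F g))"
  using assms(1)
proof (induction rule: junta_sum.induct)
  case (junta S F)
  show ?case
  proof (rule junta_sum.junta[of S])
    show "\<phi> (F g) = \<phi> (F g')" if "\<And>x. x \<in> S \<Longrightarrow> g x = g' x" for g g'
      using junta(4)[of g g', OF that] by simp
  qed (use junta in simp_all)
qed (auto simp: assms(2) intro: junta_sum.add)

text \<open>A product of two juntas reads the union of the points that they read, and products
  distribute over the sums.\<close>

lemma junta_sum_mult: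
  fixes F G :: "('x \<Rightarrow> 'y) \<Rightarrow> 'a::semiring_0"
  assumes "junta_sum X d F" "junta_sum X e G"
  shows "junta_sum X (d + e) (\<lambda>g. F g * G g)"
  using assms(1)
proof (induction rule: junta_sum.induct)
  case (junta S F)
  note S = this
  show ?case using assms(2)
  proof (induction rule: junta_sum.induct)
    case (junta R G)
    show ?case
    proof (rule junta_sum.junta[of "S \<union> R"])
      show "F g * G g = F g' * G g'" if "\<And>x. x \<in> S \<union> R \<Longrightarrow> g x = g' x" for g g'
      proof -
        have "F g = F g'" by (rule S(4)) (use that in simp)
        moreover have "G g = G g'" by (rule junta(4)) (use that in simp)
        ultimately show ?thesis by simp
      qed
      show "card (S \<union> R) \<le> d + e" using card_Un_le[of S R] S(3) junta(3) by linarith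
      show "finite (S \<union> R)" "S \<union> R \<subseteq> X" using S(1,2) junta(1,2) by auto
    qed
  qed (auto simp: distrib_left intro: junta_sum.add)
qed (auto simp: distrib_right intro: junta_sum.add)

text \<open>Where \<open>F\<close> reads the point \<open>x\<close>, the new function reads
  \<open>\<rho> x\<close> instead, so it reads no more points. This covers renaming values as well
  as freezing one half of the input.\<close>

lemma junta_sum_substitute:
  assumes "junta_sum X d F" "\<rho> ` X \<subseteq> X'"
  shows "junta_sum X' d (\<lambda>g. F (\<lambda>x. \<phi> x (g (\<rho> x))))"
  using assms(1)
proof (induction rule: junta_sum.induct)
  case (junta S F)
  have "card (\<rho> ` S) \<le> d" using card_image_le[of S \<rho>] junta by linarith
  moreover have "\<rho> ` S \<subseteq> X'" using junta(2) assms(2) by blast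
  ultimately show ?case using junta(1)
    by (intro junta_sum.junta[of "\<rho> ` S"] junta(4)) auto
qed (auto intro: junta_sum.add)

section \<open>Functions of small range\<close>

text \<open>Compares functions only by their partition of \<open>S\<close> into fibres, which is all
  that survives a random relabelling of the values.\<close>

definition same_kernel :: "'x set \<Rightarrow> ('x \<Rightarrow> 'y) \<Rightarrow> ('x \<Rightarrow> 'z) \<Rightarrow> bool" where
  "same_kernel S u v \<longleftrightarrow> (\<forall>x\<in>S. \<forall>x'\<in>S. u x = u x' \<longleftrightarrow> v x = v x')"

lemma bij_betw_same_kernel:
  assumes "same_kernel S u v"
  obtains t where "bij_betw t (u ` S) (v ` S)" "\<And>x. x \<in> S \<Longrightarrow> t (u x) = v x"
proof -
  define t where "t = (\<lambda>y. v (inv_into S u y))"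
  have t: "t (u x) = v x" if "x \<in> S" for x
    using that assms inv_into_into[of "u x" u S] f_inv_into_f[of "u x" u S]
    unfolding t_def same_kernel_def by blast
  have "t ` u ` S = v ` S" using t by force
  moreover have "inj_on t (u ` S)"
    using t assms by (auto simp: inj_on_def same_kernel_def)
  ultimately have "bij_betw t (u ` S) (v ` S)" by (simp add: bij_betw_def)
  then show thesis using t by (rule that)
qed

lemma card_image_same_kernel:
  assumes "same_kernel S u v"
  shows "card (u ` S) = card (v ` S)"
  by (rule bij_betw_same_kernel[OF assms]) (rule bij_betw_same_card)

text \<open>The two images have equal size, hence so do their complements in the finite set
  \<open>Y\<close>; the bijection between the images extends by any bijection between the
  complements.\<close>

lemma permutes_between_same_kernel:
  assumes "finite Y" "u ` S \<subseteq> Y" "v ` S \<subseteq> Y" "same_kernel S u v"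
  obtains t where "t permutes Y" "\<And>x. x \<in> S \<Longrightarrow> t (u x) = v x"
proof -
  obtain t1 where b1: "bij_betw t1 (u ` S) (v ` S)" and t1: "\<And>x. x \<in> S \<Longrightarrow> t1 (u x) = v x"
    using bij_betw_same_kernel[OF assms(4)] by blast
  have "card (Y - u ` S) = card (Y - v ` S)"
    using assms card_image_same_kernel[OF assms(4)] finite_subset[OF assms(2)] finite_subset[OF assms(3)]
    by (simp add: card_Diff_subset)
  then obtain t2 where b2: "bij_betw t2 (Y - u ` S) (Y - v ` S)"
    using assms(1) finite_same_card_bij by (metis finite_Diff)
  define t where "t y = (if y \<in> u ` S then t1 y else if y \<in> Y then t2 y else y)" for y
  have "bij_betw t (u ` S) (v ` S)"
    using b1 by (rule bij_betw_cong[THEN iffD1, rotated]) (simp add: t_def)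
  moreover have "bij_betw t (Y - u ` S) (Y - v ` S)"
    using b2 by (rule bij_betw_cong[THEN iffD1, rotated]) (simp add: t_def)
  ultimately have "bij_betw t (u ` S \<union> (Y - u ` S)) (v ` S \<union> (Y - v ` S))"
    by (rule bij_betw_combine) auto
  then have "bij_betw t Y Y" using assms(2,3) by (simp add: Un_absorb1)
  moreover have "t y = y" if "y \<notin> Y" for y using that assms(2) by (auto simp: t_def)
  ultimately have "t permutes Y" by (rule bij_imp_permutes)
  moreover have "t (u x) = v x" if "x \<in> S" for x using that t1 by (simp add: t_def)
  ultimately show thesis by (rule that)
qed

section \<open>Random relabelling and the polynomial in 1/r\<close>

text \<open>When the values of \<open>h\<close> lie below \<open>M\<close>, a random permutation of
  \<open>M\<close> labels acts as a random injective labelling of the classes of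
  \<open>h\<close>.\<close>

definition relabel_avg :: "nat \<Rightarrow> ((nat \<Rightarrow> nat) \<Rightarrow> real) \<Rightarrow> (nat \<Rightarrow> nat) \<Rightarrow> real" where
  "relabel_avg M F h = avg {\<sigma>. \<sigma> permutes {..<M}} (\<lambda>\<sigma>. F (\<sigma> \<circ> h))"

lemma relabel_avg_add:
  "relabel_avg M (\<lambda>g. F g + G g) h = relabel_avg M F h + relabel_avg M G h"
  by (simp add: relabel_avg_def avg_def sum.distrib add_divide_distrib)

lemma finite_nonempty_permutes: "finite {\<sigma>. \<sigma> permutes {..<M::nat}}" "{\<sigma>. \<sigma> permutes {..<M::nat}} \<noteq> {}"
  using permutes_id[of "{..<M}"] by (auto simp: finite_permutations intro!: exI[of _ id])

text \<open>A permutation \<open>t\<close> carries \<open>u\<close> to \<open>v\<close> on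
  \<open>S\<close>, and replacing \<open>\<sigma>\<close> by \<open>\<sigma> \<circ> t\<close> only
  reorders the average.\<close>

lemma relabel_avg_same_kernel:
  assumes dep: "\<And>g g'. (\<And>x. x \<in> S \<Longrightarrow> g x = g' x) \<Longrightarrow> F g = F g'"
    and "u ` S \<subseteq> {..<M}" "v ` S \<subseteq> {..<M}" "same_kernel S u v"
  shows "relabel_avg M F u = relabel_avg M F v"
proof -
  obtain t where t: "t permutes {..<M}" "\<And>x. x \<in> S \<Longrightarrow> t (u x) = v x"
    using permutes_between_same_kernel[OF _ assms(2-4)] by blast
  have "(\<Sum>\<sigma> | \<sigma> permutes {..<M}. F (\<sigma> \<circ> u)) = (\<Sum>\<sigma> | \<sigma> permutes {..<M}. F ((\<sigma> \<circ> t) \<circ> u))"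
    using t(1) by (rule sum_permutations_compose_right)
  also have "\<dots> = (\<Sum>\<sigma> | \<sigma> permutes {..<M}. F (\<sigma> \<circ> v))"
    by (intro sum.cong refl dep) (simp add: t(2))
  finally show ?thesis by (simp add: relabel_avg_def avg_def)
qed

lemma sum_PiE_insert:
  assumes "x \<notin> X"
  shows "(\<Sum>h\<in>insert x X \<rightarrow>\<^sub>E R. f h) = (\<Sum>h\<in>X \<rightarrow>\<^sub>E R. \<Sum>v\<in>R. f (h(x := v)))"
proof -
  have "(\<Sum>h\<in>insert x X \<rightarrow>\<^sub>E R. f h) = (\<Sum>p\<in>R \<times> (X \<rightarrow>\<^sub>E R). f ((\<lambda>(y, g). g(x := y)) p))"
    unfolding PiE_insert_eq using inj_combinator[OF assms, of "\<lambda>_. R"]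
    by (subst sum.reindex) (auto simp: o_def)
  also have "\<dots> = (\<Sum>v\<in>R. \<Sum>h\<in>X \<rightarrow>\<^sub>E R. f (h(x := v)))"
    by (simp add: sum.cartesian_product case_prod_beta)
  finally show ?thesis by (simp add: sum.swap[of _ _ R])
qed

text \<open>
  Exactly \<open>r (r - 1) \<cdots> (r - k + 1) r\<^bsup>|X| - |S|\<^esup>\<close> functions have a given kernel with \<open>k\<close> classes on \<open>S\<close>.
\<close>

lemma same_kernel_frequency_polynomial:
  assumes "finite X" "S \<subseteq> X"
  shows "\<exists>q. degree q \<le> card S \<and> poly q 0 = of_bool (inj_on y S) \<and>
    (\<forall>r\<ge>1. (\<Sum>h\<in>X \<rightarrow>\<^sub>E {..<r}. of_bool (same_kernel S y h)) =
      real r ^ card X * poly q (1 / real r))"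
  using assms
proof (induction X arbitrary: S rule: finite_induct)
  case empty
  then show ?case by (intro exI[of _ 1]) (auto simp: same_kernel_def)
next
  case (insert x X)
  show ?case
  proof (cases "x \<in> S")
    case False
    then have "S \<subseteq> X" using insert.prems by auto
    from insert.IH[OF this] obtain q where q: "degree q \<le> card S" "poly q 0 = of_bool (inj_on y S)"
      "\<And>r. r \<ge> 1 \<Longrightarrow> (\<Sum>h\<in>X \<rightarrow>\<^sub>E {..<r}. of_bool (same_kernel S y h)) =
        real r ^ card X * poly q (1 / real r)" by blast
    \<comment> \<open>A point outside \<open>S\<close> is unconstrained and contributes a factor
      \<open>r\<close>.\<close>
    have "same_kernel S y (h(x := v)) \<longleftrightarrow> same_kernel S y h" for h :: "'a \<Rightarrow> nat" and v
      using False by (auto simp: same_kernel_def)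
    then have "(\<Sum>h\<in>insert x X \<rightarrow>\<^sub>E {..<r}. of_bool (same_kernel S y h)) =
        real r ^ card (insert x X) * poly q (1 / real r)" if "r \<ge> 1" for r
      using insert.hyps q(3)[OF that] by (simp add: sum_PiE_insert sum_distrib_left[symmetric])
    then show ?thesis using q by blast
  next
    case True
    define S' where "S' = S - {x}"
    have S: "S = insert x S'" "x \<notin> S'" "S' \<subseteq> X" "finite S'"
      using True insert finite_subset[of S "insert x X"] by (auto simp: S'_def)
    from insert.IH[OF S(3)] obtain q where q: "degree q \<le> card S'" "poly q 0 = of_bool (inj_on y S')"
      "\<And>r. r \<ge> 1 \<Longrightarrow> (\<Sum>h\<in>X \<rightarrow>\<^sub>E {..<r}. of_bool (same_kernel S' y h)) =
        real r ^ card X * poly q (1 / real r)" by blast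
    \<comment> \<open>If \<open>x\<close> joins an existing class, its value is forced: 1 = r *
      (1/r) choices. If it opens a new class, it avoids the \<open>k\<close> values in use: r - k =
      r * (1 - k/r) choices. At 0 the polynomial \<open>c\<close> is 0 or 1 accordingly, which
      tracks injectivity.\<close>
    define c where "c = (if y x \<in> y ` S' then [:0, 1:] else [:1, - real (card (y ` S')):])"
    have count: "(\<Sum>v<r. of_bool (same_kernel S y (h(x := v)))) =
        of_bool (same_kernel S' y h) * (real r * poly c (1 / real r))"
      if r: "r \<ge> 1" and h: "h \<in> X \<rightarrow>\<^sub>E {..<r}" for r h
    proof (cases "same_kernel S' y h")
      case False
      then have "\<not> same_kernel S y (h(x := v))" for v
        using S by (auto simp: same_kernel_def)
      then show ?thesis using False by simp
    next
      case True
      have iff: "same_kernel S y (h(x := v)) \<longleftrightarrow> (\<forall>x'\<in>S'. y x = y x' \<longleftrightarrow> v = h x')" for v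
        using True S unfolding same_kernel_def by (auto simp: eq_commute)
      show ?thesis
      proof (cases "y x \<in> y ` S'")
        case T: True
        then obtain z where z: "z \<in> S'" "y x = y z" by auto
        have "same_kernel S y (h(x := v)) \<longleftrightarrow> v = h z" for v
          unfolding iff using z True by (auto simp: same_kernel_def)
        moreover have "h z < r" using h z S by auto
        ultimately show ?thesis using r True T by (simp add: c_def of_bool_def)
      next
        case F: False
        have eq: "{v. v < r \<and> same_kernel S y (h(x := v))} = {..<r} - h ` S'"
          unfolding iff using F by auto
        have "h ` S' \<subseteq> {..<r}" using h S by auto
        moreover have "card (h ` S') = card (y ` S')"
          using card_image_same_kernel[OF True] by simp
        ultimately have "real (card ({..<r} - h ` S')) = real r - real (card (y ` S'))"
          using S(4) card_mono[of "{..<r}" "h ` S'"]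
          by (simp add: card_Diff_subset of_nat_diff)
        moreover have "(\<Sum>v<r. of_bool (same_kernel S y (h(x := v)))) =
            real (card {v. v < r \<and> same_kernel S y (h(x := v))})"
          by (simp add: of_bool_def sum.If_cases Int_def)
        moreover have "real r * poly c (1 / real r) = real r - real (card (y ` S'))"
          using F r by (simp add: c_def algebra_simps)
        ultimately show ?thesis unfolding eq using True by simp
      qed
    qed
    have "(\<Sum>h\<in>insert x X \<rightarrow>\<^sub>E {..<r}. of_bool (same_kernel S y h)) =
        real r ^ card (insert x X) * poly (c * q) (1 / real r)" if "r \<ge> 1" for r
    proof -
      have "(\<Sum>h\<in>insert x X \<rightarrow>\<^sub>E {..<r}. of_bool (same_kernel S y h)) =
          (\<Sum>h\<in>X \<rightarrow>\<^sub>E {..<r}. of_bool (same_kernel S' y h)) * (real r * poly c (1 / real r))"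
        unfolding sum_PiE_insert[OF insert.hyps(2)] sum_distrib_right
        by (intro sum.cong refl count that)
      then show ?thesis using q(3)[OF that] insert.hyps by simp
    qed
    moreover have "degree (c * q) \<le> card S"
    proof -
      have "degree c \<le> 1" by (simp add: c_def)
      then show ?thesis using degree_mult_le[of c q] q(1) S by simp
    qed
    moreover have "poly (c * q) 0 = of_bool (inj_on y S)"
      using q(2) S by (auto simp: c_def)
    ultimately show ?thesis by blast
  qed
qed

text \<open>Names every value of \<open>h\<close> by the first point where it is attained, so that the number of
  available values does not matter.\<close>

definition first_occurrence :: "(nat \<Rightarrow> 'b) \<Rightarrow> nat \<Rightarrow> nat" where
  "first_occurrence h x = (LEAST z. h z = h x)"

lemma first_occurrence_le: "first_occurrence h x \<le> x"
  unfolding first_occurrence_def by (rule Least_le) simp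

lemma first_occurrence_eq_iff: "first_occurrence h x = first_occurrence h x' \<longleftrightarrow> h x = h x'"
proof
  assume "first_occurrence h x = first_occurrence h x'"
  moreover have "h (first_occurrence h z) = h z" for z
    unfolding first_occurrence_def by (rule LeastI[of _ z]) simp
  ultimately show "h x = h x'" by metis
qed (simp add: first_occurrence_def)

lemma first_occurrence_id: "first_occurrence id = id"
  by (auto simp: first_occurrence_def intro!: ext Least_equality)

text \<open>The relabelled average of a junta depends only on the kernel of \<open>h\<close> on
  \<open>S\<close>. Summing over the finitely many kernels, each weighted by its frequency
  polynomial, gives \<open>q\<close>; at 0 only the injective kernel remains.\<close>

lemma junta_relabel_avg_polynomial:
  fixes F :: "(nat \<Rightarrow> nat) \<Rightarrow> real"
  assumes "S \<subseteq> {..<m}" "m \<le> M"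
    and dep: "\<And>g g'. (\<And>x. x \<in> S \<Longrightarrow> g x = g' x) \<Longrightarrow> F g = F g'"
  shows "\<exists>q. degree q \<le> card S \<and> poly q 0 = relabel_avg M F id \<and>
    (\<forall>r\<ge>1. (\<Sum>h\<in>{..<m} \<rightarrow>\<^sub>E {..<r}. relabel_avg M F (first_occurrence h)) =
      real r ^ m * poly q (1 / real r))"
proof -
  have finS: "finite S" using assms(1) finite_subset by blast
  \<comment> \<open>Each kernel gets a canonical representative: every point of \<open>S\<close> is
    sent to the least point of \<open>S\<close> in its class. As these are maps from
    \<open>S\<close> to \<open>S\<close>, there are finitely many, whatever the range of
    \<open>h\<close>.\<close>
  define L where "L h x = (LEAST z. z \<in> S \<and> h z = h x)" for h :: "nat \<Rightarrow> nat" and x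
  define rep where "rep h = restrict (L h) S" for h
  define R where "R = range rep"
  have least: "L h x \<in> S" "h (L h x) = h x" if "x \<in> S" for h x
    using LeastI[of "\<lambda>z. z \<in> S \<and> h z = h x" x] that by (simp_all add: L_def)
  have L_cong: "L h x = L h' x'" if "same_kernel S h h'" "h x = h x'" "x \<in> S" "x' \<in> S" for h h' x x'
  proof -
    have "(\<lambda>z. z \<in> S \<and> h z = h x) = (\<lambda>z. z \<in> S \<and> h' z = h' x')"
      using that by (auto simp: same_kernel_def)
    then show ?thesis by (simp only: L_def)
  qed
  have rep: "same_kernel S (rep h) h" for h
    unfolding same_kernel_def
  proof (intro ballI iffI)
    fix x x' assume "x \<in> S" "x' \<in> S" "rep h x = rep h x'"
    then show "h x = h x'" by (metis least(2) rep_def restrict_apply')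
  qed (auto simp: rep_def same_kernel_def intro: L_cong)
  have rep_eq: "rep h = rep h'" if "same_kernel S h h'" for h h'
    unfolding rep_def using that by (intro restrict_ext L_cong) auto
  have R_iff: "same_kernel S y h \<longleftrightarrow> y = rep h" if "y \<in> R" for y h
  proof
    obtain k where k: "y = rep k" using \<open>y \<in> R\<close> by (auto simp: R_def)
    assume "same_kernel S y h"
    then have "same_kernel S k h" using rep[of k] unfolding k same_kernel_def by blast
    then show "y = rep h" using rep_eq k by simp
  qed (use rep in auto)
  have "R \<subseteq> S \<rightarrow>\<^sub>E S" using least(1) by (auto simp: R_def rep_def)
  then have finR: "finite R" and R_ran: "\<And>y. y \<in> R \<Longrightarrow> y ` S \<subseteq> S"
    using finS finite_PiE[of S "\<lambda>_. S"] by (auto dest: finite_subset)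
  have expand: "relabel_avg M F (first_occurrence h) =
      (\<Sum>y\<in>R. of_bool (same_kernel S y h) * relabel_avg M F y)" for h :: "nat \<Rightarrow> nat"
  proof -
    have "(\<Sum>y\<in>R. of_bool (same_kernel S y h) * relabel_avg M F y) =
        (\<Sum>y\<in>R. if y = rep h then relabel_avg M F y else 0)"
      by (intro sum.cong refl) (auto simp: R_iff)
    also have "\<dots> = relabel_avg M F (rep h)" using finR by (simp add: R_def)
    also have "\<dots> = relabel_avg M F (first_occurrence h)"
    proof (rule relabel_avg_same_kernel[of S])
      have "S \<subseteq> {..<M}" using assms(1,2) by (meson lessThan_subset_iff order_trans)
      then show "rep h ` S \<subseteq> {..<M}" using R_ran[of "rep h"] by (auto simp: R_def)
      show "first_occurrence h ` S \<subseteq> {..<M}"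
        using \<open>S \<subseteq> {..<M}\<close> by (blast intro: le_less_trans[OF first_occurrence_le])
      show "F g = F g'" if "\<And>x. x \<in> S \<Longrightarrow> g x = g' x" for g g'
        using that by (rule dep)
      show "same_kernel S (rep h) (first_occurrence h)"
        using rep[of h] by (auto simp: same_kernel_def first_occurrence_eq_iff)
    qed
    finally show ?thesis by simp
  qed
  have "\<forall>y :: nat \<Rightarrow> nat. \<exists>q. degree q \<le> card S \<and> poly q 0 = of_bool (inj_on y S) \<and>
      (\<forall>r\<ge>1. (\<Sum>h\<in>{..<m} \<rightarrow>\<^sub>E {..<r}. of_bool (same_kernel S y h)) =
        real r ^ card {..<m} * poly q (1 / real r))" (is "\<forall>y. \<exists>q. ?P y q")
    by (intro allI same_kernel_frequency_polynomial finite_lessThan assms(1))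
  from choice[OF this] obtain q where q: "\<And>y. ?P y (q y)" by blast
  define Q where "Q = (\<Sum>y\<in>R. smult (relabel_avg M F y) (q y))"
  have "degree Q \<le> card S"
    unfolding Q_def using finR q by (intro degree_sum_le) (auto intro: order_trans[OF degree_smult_le])
  moreover have "poly Q 0 = relabel_avg M F id"
  proof -
    \<comment> \<open>Having the kernel of \<open>id\<close> means being injective, so the expansion
      of \<open>id\<close> has exactly the values at 0 of the frequency polynomials as
      coefficients.\<close>
    have "same_kernel S y id \<longleftrightarrow> inj_on y S" for y :: "nat \<Rightarrow> nat"
      by (auto simp: same_kernel_def inj_on_def)
    then show ?thesis using expand[of id] q
      by (simp add: Q_def poly_sum first_occurrence_id mult.commute)
  qed
  moreover have "(\<Sum>h\<in>{..<m} \<rightarrow>\<^sub>E {..<r}. relabel_avg M F (first_occurrence h)) =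
      real r ^ m * poly Q (1 / real r)" if r: "r \<ge> 1" for r
  proof -
    have "(\<Sum>h\<in>{..<m} \<rightarrow>\<^sub>E {..<r}. relabel_avg M F (first_occurrence h)) =
        (\<Sum>y\<in>R. (\<Sum>h\<in>{..<m} \<rightarrow>\<^sub>E {..<r}. of_bool (same_kernel S y h)) * relabel_avg M F y)"
      unfolding expand sum_distrib_right by (rule sum.swap)
    also have "\<dots> = (\<Sum>y\<in>R. real r ^ m * (relabel_avg M F y * poly (q y) (1 / real r)))"
      using q r by (intro sum.cong refl) (simp add: mult_ac)
    finally show ?thesis by (simp add: Q_def poly_sum sum_distrib_left)
  qed
  ultimately show ?thesis by blast
qed

text \<open>Polynomials of the single juntas add up. The labels from \<open>first_occurrence\<close>
  stay below \<open>m \<le> M\<close>, so one polynomial serves all \<open>r \<ge> 1\<close>,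
  including \<open>r > M\<close>, as interpolation requires.\<close>

lemma relabel_avg_polynomial:
  fixes F :: "(nat \<Rightarrow> nat) \<Rightarrow> real"
  assumes "junta_sum {..<m} d F" "m \<le> M"
  shows "\<exists>q. degree q \<le> d \<and> poly q 0 = relabel_avg M F id \<and>
    (\<forall>r\<ge>1. avg ({..<m} \<rightarrow>\<^sub>E {..<r}) (\<lambda>h. relabel_avg M F (first_occurrence h)) = poly q (1 / real r))"
  using assms(1)
proof (induction rule: junta_sum.induct)
  case (junta S F)
  have "F g = F g'" if "\<And>x. x \<in> S \<Longrightarrow> g x = g' x" for g g'
    using that by (rule junta(4))
  from junta_relabel_avg_polynomial[of S m M F, OF junta(2) assms(2) this]
  obtain q where "degree q \<le> card S" "poly q 0 = relabel_avg M F id"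
    "\<forall>r\<ge>1. (\<Sum>h\<in>{..<m} \<rightarrow>\<^sub>E {..<r}. relabel_avg M F (first_occurrence h)) =
      real r ^ m * poly q (1 / real r)" by auto
  then show ?case using junta(3) by (intro exI[of _ q]) (auto simp: avg_def card_funcsetE id_def)
next
  case (add F G)
  let ?avg = "\<lambda>F r. avg ({..<m} \<rightarrow>\<^sub>E {..<r}) (\<lambda>h. relabel_avg M F (first_occurrence h))"
  obtain p where p: "degree p \<le> d" "poly p 0 = relabel_avg M F id"
    "\<forall>r\<ge>1. ?avg F r = poly p (1 / real r)"
    using add.IH(1) by (elim exE conjE)
  obtain q where q: "degree q \<le> d" "poly q 0 = relabel_avg M G id"
    "\<forall>r\<ge>1. ?avg G r = poly q (1 / real r)"
    using add.IH(2) by (elim exE conjE)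
  have "?avg (\<lambda>g. F g + G g) r = poly (p + q) (1 / real r)" if "r \<ge> 1" for r
  proof -
    have "?avg (\<lambda>g. F g + G g) r = ?avg F r + ?avg G r"
      by (simp add: relabel_avg_add avg_def sum.distrib add_divide_distrib)
    then show ?thesis using p(3) q(3) that by simp
  qed
  moreover have "poly (p + q) 0 = relabel_avg M (\<lambda>g. F g + G g) id"
    by (simp only: poly_add p(2) q(2) relabel_avg_add)
  moreover have "degree (p + q) \<le> d" using p(1) q(1) by (rule degree_add_le)
  ultimately show ?case unfolding id_def by blast
qed

section \<open>Comparing random permutations with random functions\<close>

lemma finite_nonempty_PiE:
  assumes "n \<ge> 1"
  shows "finite ({..<m} \<rightarrow>\<^sub>E {..<n::nat})" "({..<m::nat} \<rightarrow>\<^sub>E {..<n}) \<noteq> {}"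
  using assms by (auto simp: finite_PiE PiE_eq_empty_iff lessThan_empty_iff)

text \<open>The two averages are the values at 0 and 1/r of the polynomial of
  \<open>relabel_avg_polynomial\<close>. At each 1/k that polynomial is an average of values of
  \<open>F\<close>, hence in [0, 1], and \<open>poly_reciprocal_difference\<close> applies.\<close>

lemma permutation_vs_function_through_small_range:
  fixes F :: "(nat \<Rightarrow> nat) \<Rightarrow> real"
  assumes F: "junta_sum {..<m} d F" "\<And>g. F g \<in> {0..1}" and "m \<le> M" "1 \<le> r" "r \<le> M"
  shows "\<bar>avg {\<sigma>. \<sigma> permutes {..<M}} F -
      avg ({..<m} \<rightarrow>\<^sub>E {..<r}) (\<lambda>h. avg {\<sigma>. \<sigma> permutes {..<M}} (\<lambda>\<sigma>. F (\<sigma> \<circ> h)))\<bar>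
    \<le> 16 * real d ^ 5 / real r"
proof -
  obtain q where q: "degree q \<le> d" "poly q 0 = relabel_avg M F id"
    "\<And>r. r \<ge> 1 \<Longrightarrow>
      avg ({..<m} \<rightarrow>\<^sub>E {..<r}) (\<lambda>h. relabel_avg M F (first_occurrence h)) = poly q (1 / real r)"
    using relabel_avg_polynomial[OF F(1) assms(3)] by blast
  have relabel01: "relabel_avg M F h \<in> {0..1}" for h
    unfolding relabel_avg_def by (intro avg_bounds F finite_nonempty_permutes)
  have "poly q (1 / real k) \<in> {0..1}" if "k \<ge> 1" for k
    unfolding q(3)[OF that, symmetric] by (intro avg_bounds relabel01 finite_nonempty_PiE that)
  then have "\<bar>poly q 0 - poly q (1 / real r)\<bar> \<le> 16 * real d ^ 5 / real r"
    using q relabel01[of id] assms(4) by (intro poly_reciprocal_difference) auto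
  \<comment> \<open>For \<open>r \<le> M\<close> the values of \<open>h\<close> are themselves
    admissible labels, so the renaming can be undone.\<close>
  moreover have "relabel_avg M F (first_occurrence h) = relabel_avg M F h"
    if h: "h \<in> {..<m} \<rightarrow>\<^sub>E {..<r}" for h
  proof (rule relabel_avg_same_kernel[of "{..<m}"])
    show "F g = F g'" if "\<And>x. x \<in> {..<m} \<Longrightarrow> g x = g' x" for g g'
      using junta_sum_cong[OF F(1)] that by blast
    show "first_occurrence h ` {..<m} \<subseteq> {..<M}"
    proof (rule image_subsetI)
      fix x assume "x \<in> {..<m}"
      then show "first_occurrence h x \<in> {..<M}"
        using assms(3) first_occurrence_le[of h x] by simp
    qed
    show "h ` {..<m} \<subseteq> {..<M}"
    proof (rule image_subsetI)
      fix x assume "x \<in> {..<m}"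
      then show "h x \<in> {..<M}" using PiE_mem[OF h] assms(5) by fastforce
    qed
  qed (auto simp: same_kernel_def first_occurrence_eq_iff)
  then have "avg ({..<m} \<rightarrow>\<^sub>E {..<r}) (\<lambda>h. relabel_avg M F h) = poly q (1 / real r)"
    unfolding q(3)[OF assms(4), symmetric] by (intro avg_cong) simp
  ultimately show ?thesis unfolding q(2) by (simp add: relabel_avg_def)
qed

text \<open>Following a uniformly random function by a fixed permutation leaves it uniformly random,
  so for \<open>m = r = M = n\<close> the average over \<open>\<sigma>\<close> disappears.\<close>

lemma permutation_vs_function:
  fixes F :: "(nat \<Rightarrow> nat) \<Rightarrow> real"
  assumes F: "junta_sum {..<n} d F" "\<And>g. F g \<in> {0..1}" and "1 \<le> n"
  shows "\<bar>avg {\<sigma>. \<sigma> permutes {..<n}} F - avg ({..<n} \<rightarrow>\<^sub>E {..<n}) F\<bar> \<le> 16 * real d ^ 5 / real n"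
proof -
  let ?P = "{\<sigma>. \<sigma> permutes {..<n}}" and ?H = "{..<n} \<rightarrow>\<^sub>E {..<n}"
  have "avg ?H (\<lambda>h. F (\<sigma> \<circ> h)) = avg ?H F" if \<sigma>: "\<sigma> permutes {..<n}" for \<sigma>
  proof -
    have "bij_betw (\<lambda>h. restrict (\<sigma> \<circ> h) {..<n}) ?H ?H"
    proof (rule bij_betwI[where g = "\<lambda>h. restrict (inv_into UNIV \<sigma> \<circ> h) {..<n}"])
      show "(\<lambda>h. restrict (\<sigma> \<circ> h) {..<n}) \<in> ?H \<rightarrow> ?H"
        using permutes_in_image[OF \<sigma>] by (auto simp: PiE_def Pi_def)
      show "(\<lambda>h. restrict (inv_into UNIV \<sigma> \<circ> h) {..<n}) \<in> ?H \<rightarrow> ?H"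
        using permutes_in_image[OF permutes_inv[OF \<sigma>]] by (auto simp: PiE_def Pi_def)
    qed (auto simp: fun_eq_iff PiE_def extensional_def permutes_inverses[OF \<sigma>])
    then have "avg ?H (\<lambda>h. F (restrict (\<sigma> \<circ> h) {..<n})) = avg ?H F" by (rule avg_reindex_bij)
    moreover have "F (restrict (\<sigma> \<circ> h) {..<n}) = F (\<sigma> \<circ> h)" for h
      by (rule junta_sum_cong[OF F(1)]) simp
    ultimately show ?thesis by simp
  qed
  then have "avg ?H (\<lambda>h. avg ?P (\<lambda>\<sigma>. F (\<sigma> \<circ> h))) = avg ?P (\<lambda>_. avg ?H F)"
    by (subst avg_swap) (auto intro: avg_cong)
  then have "avg ?H (\<lambda>h. avg ?P (\<lambda>\<sigma>. F (\<sigma> \<circ> h))) = avg ?H F"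
    by (simp only: avg_const[OF finite_nonempty_permutes])
  then show ?thesis
    using permutation_vs_function_through_small_range[OF F order_refl assms(3) order_refl] by simp
qed

text \<open>Three replacements, each costing \<open>16 * d ^ 5 / n\<close>: the permutation of
  \<open>2 * n\<close> points by a relabelled function of range \<open>n\<close>, then the first
  half of that function by a permutation, then the second half.\<close>

lemma disjoint_vs_equal_images:
  fixes F :: "(nat \<Rightarrow> nat) \<Rightarrow> real"
  assumes F: "junta_sum {..<n + n} d F" "\<And>g. F g \<in> {0..1}" and n: "1 \<le> n"
  defines "P \<equiv> {\<sigma>. \<sigma> permutes {..<n + n}}" and "R \<equiv> {\<tau>. \<tau> permutes {..<n}}"
  shows "\<bar>avg P F - avg P (\<lambda>\<sigma>. avg R (\<lambda>g. avg R (\<lambda>h. F (\<sigma> \<circ> glue n g h))))\<bar>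
    \<le> 48 * real d ^ 5 / real n"
proof -
  let ?H = "{..<n} \<rightarrow>\<^sub>E {..<n}" and ?e = "16 * real d ^ 5 / real n"
  note fin = finite_nonempty_permutes[of "n + n", folded P_def] finite_nonempty_permutes[of n, folded R_def]
    finite_nonempty_PiE[OF n]
  have "\<bar>avg P F - avg ({..<n + n} \<rightarrow>\<^sub>E {..<n}) (\<lambda>h. avg P (\<lambda>\<sigma>. F (\<sigma> \<circ> h)))\<bar> \<le> ?e"
    unfolding P_def using n by (intro permutation_vs_function_through_small_range F) auto
  moreover have "avg ({..<n + n} \<rightarrow>\<^sub>E {..<n}) (\<lambda>h. avg P (\<lambda>\<sigma>. F (\<sigma> \<circ> h))) =
      avg P (\<lambda>\<sigma>. avg ?H (\<lambda>g. avg ?H (\<lambda>h. F (\<sigma> \<circ> glue n g h))))"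
  proof -
    have "F (\<sigma> \<circ> restrict k {..<n + n}) = F (\<sigma> \<circ> k)" for \<sigma> k
      by (rule junta_sum_cong[OF F(1)]) simp
    note restrict_eq = this
    show ?thesis by (subst avg_swap) (simp only: avg_PiE_add restrict_eq)
  qed
  moreover have "\<bar>avg P (\<lambda>\<sigma>. avg R (\<lambda>g. avg ?H (\<lambda>h. F (\<sigma> \<circ> glue n g h)))) -
      avg P (\<lambda>\<sigma>. avg ?H (\<lambda>g. avg ?H (\<lambda>h. F (\<sigma> \<circ> glue n g h))))\<bar> \<le> ?e"
  proof (intro abs_avg_diff_le fin)
    fix \<sigma>
    have "\<bar>avg ?H (\<lambda>h. avg R (\<lambda>g. F (\<sigma> \<circ> glue n g h))) -
        avg ?H (\<lambda>h. avg ?H (\<lambda>g. F (\<sigma> \<circ> glue n g h)))\<bar> \<le> ?e"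
      unfolding R_def
    proof (intro abs_avg_diff_le fin permutation_vs_function n F(2))
      fix h
      \<comment> \<open>With \<open>\<sigma>\<close> and \<open>h\<close> fixed, only the points
        below \<open>n\<close> depend on \<open>g\<close>; the others nominally read the point 0 and
        ignore the result.\<close>
      have "junta_sum {..<n} d (\<lambda>g. F (\<lambda>x. (if x < n then \<sigma> else (\<lambda>_. \<sigma> (h (x - n))))
          (g (if x < n then x else 0))))"
        using n by (intro junta_sum_substitute[OF F(1)]) auto
      then show "junta_sum {..<n} d (\<lambda>g. F (\<sigma> \<circ> glue n g h))"
        by (rule back_subst[of "junta_sum {..<n} d"]) (auto intro!: ext arg_cong[where f = F])
    qed
    then show "\<bar>avg R (\<lambda>g. avg ?H (\<lambda>h. F (\<sigma> \<circ> glue n g h))) -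
        avg ?H (\<lambda>g. avg ?H (\<lambda>h. F (\<sigma> \<circ> glue n g h)))\<bar> \<le> ?e"
      by (simp only: avg_swap[of R ?H] avg_swap[of ?H ?H "\<lambda>g h. F (\<sigma> \<circ> glue n g h)"])
  qed
  moreover have "\<bar>avg P (\<lambda>\<sigma>. avg R (\<lambda>g. avg R (\<lambda>h. F (\<sigma> \<circ> glue n g h)))) -
      avg P (\<lambda>\<sigma>. avg R (\<lambda>g. avg ?H (\<lambda>h. F (\<sigma> \<circ> glue n g h))))\<bar> \<le> ?e"
  proof (intro abs_avg_diff_le fin)
    fix \<sigma> g
    show "\<bar>avg R (\<lambda>h. F (\<sigma> \<circ> glue n g h)) - avg ?H (\<lambda>h. F (\<sigma> \<circ> glue n g h))\<bar> \<le> ?e"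
      unfolding R_def
    proof (intro permutation_vs_function n F(2))
      \<comment> \<open>For \<open>x < n\<close> the truncated difference \<open>x - n\<close> is 0,
        and the value read there is ignored.\<close>
      have "junta_sum {..<n} d (\<lambda>h. F (\<lambda>x. (if x < n then (\<lambda>_. \<sigma> (g x)) else \<sigma>) (h (x - n))))"
        using n by (intro junta_sum_substitute[OF F(1)]) auto
      then show "junta_sum {..<n} d (\<lambda>h. F (\<sigma> \<circ> glue n g h))"
        by (rule back_subst[of "junta_sum {..<n} d"]) (auto intro!: ext arg_cong[where f = F])
    qed
  qed
  ultimately have "\<bar>avg P F - avg P (\<lambda>\<sigma>. avg R (\<lambda>g. avg R (\<lambda>h. F (\<sigma> \<circ> glue n g h))))\<bar> \<le> 3 * ?e"
    by linarith
  then show ?thesis by simp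
qed

section \<open>Query algorithms\<close>

lemma mult_mat_vec_index_sum:
  assumes "A \<in> carrier_mat d d" "v \<in> carrier_vec d" "i < d"
  shows "(A *\<^sub>v v) $ i = (\<Sum>j<d. A $$ (i, j) * v $ j)"
  using assms by (auto simp: scalar_prod_def lessThan_atLeast0 intro!: sum.cong)

text \<open>The columns of \<open>U\<close> are orthonormal, so only the diagonal terms of the
  expanded squares survive.\<close>

lemma unitary_matrix_norm:
  assumes "unitary_matrix d U" "v \<in> carrier_vec d"
  shows "(\<Sum>k<d. (cmod ((U *\<^sub>v v) $ k))\<^sup>2) = (\<Sum>k<d. (cmod (v $ k))\<^sup>2)"
proof -
  have U: "U \<in> carrier_mat d d" "mat_adjoint U * U = 1\<^sub>m d"
    using assms by (auto simp: unitary_matrix_def)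
  have orth: "(\<Sum>r<d. cnj (U $$ (r, i)) * U $$ (r, j)) = of_bool (i = j)" if "i < d" "j < d" for i j
  proof -
    have "(mat_adjoint U * U) $$ (i, j) = (\<Sum>r<d. cnj (U $$ (r, i)) * U $$ (r, j))"
      using U(1) that
      by (auto simp: mat_adjoint_def scalar_prod_def lessThan_atLeast0 mat_of_rows_index intro!: sum.cong)
    then have "(\<Sum>r<d. cnj (U $$ (r, i)) * U $$ (r, j)) = 1\<^sub>m d $$ (i, j)"
      unfolding U(2) by (rule sym)
    then show ?thesis using that by simp
  qed
  have "complex_of_real (\<Sum>r<d. (cmod ((U *\<^sub>v v) $ r))\<^sup>2) =
      (\<Sum>r<d. (\<Sum>j<d. U $$ (r, j) * v $ j) * cnj (\<Sum>i<d. U $$ (r, i) * v $ i))"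
    unfolding of_real_sum complex_norm_square
    by (intro sum.cong refl) (simp only: lessThan_iff mult_mat_vec_index_sum[OF U(1) assms(2)])
  also have "\<dots> = (\<Sum>r<d. \<Sum>j<d. \<Sum>i<d. cnj (U $$ (r, i)) * U $$ (r, j) * (v $ j * cnj (v $ i)))"
    by (simp add: sum_product mult_ac)
  also have "\<dots> = (\<Sum>j<d. \<Sum>i<d. \<Sum>r<d. cnj (U $$ (r, i)) * U $$ (r, j) * (v $ j * cnj (v $ i)))"
  proof -
    have "(\<Sum>r<d. \<Sum>j<d. \<Sum>i<d. f r j i) = (\<Sum>j<d. \<Sum>i<d. \<Sum>r<d. f r j i)"
      for f :: "nat \<Rightarrow> nat \<Rightarrow> nat \<Rightarrow> complex"
      unfolding sum.swap[of "\<lambda>r j. \<Sum>i<d. f r j i"] by (rule sum.cong[OF refl]) (rule sum.swap)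
    then show ?thesis .
  qed
  also have "\<dots> = (\<Sum>j<d. \<Sum>i<d. of_bool (i = j) * (v $ j * cnj (v $ i)))"
    by (intro sum.cong refl) (simp add: sum_distrib_right[symmetric] orth)
  also have "\<dots> = (\<Sum>j<d. v $ j * cnj (v $ j))"
    by (intro sum.cong refl) simp
  also have "\<dots> = complex_of_real (\<Sum>k<d. (cmod (v $ k))\<^sup>2)"
    by (simp only: of_real_sum complex_norm_square)
  finally show ?thesis by (simp only: of_real_eq_iff)
qed

section \<open>The oracle as a permutation of the basis states\<close>

text \<open>The row of the single entry 1 in column \<open>k\<close> of the oracle matrix.\<close>

definition oracle_target :: "nat \<Rightarrow> nat \<Rightarrow> (nat \<Rightarrow> nat) \<Rightarrow> nat \<Rightarrow> nat" where
  "oracle_target N W g k = basis_index N W (k div (N * W))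
     ((k div W mod N + g (k div (N * W))) mod N) (k mod W)"

lemma query_oracle_index:
  "r < m * N * W \<Longrightarrow> k < m * N * W \<Longrightarrow>
    query_oracle m N W g $$ (r, k) = of_bool (r = oracle_target N W g k)"
  by (simp add: query_oracle_def oracle_target_def)

lemma query_oracle_carrier: "query_oracle m N W g \<in> carrier_mat (m * N * W) (m * N * W)"
  by (simp add: query_oracle_def)

lemma basis_index_inject:
  assumes "basis_index N W i y z = basis_index N W i' y' z'" "y < N" "y' < N" "z < W" "z' < W"
  shows "i = i' \<and> y = y' \<and> z = z'"
proof -
  have "i * N + y = i' * N + y'"
    using arg_cong[OF assms(1), of "\<lambda>k. k div W"] assms(4,5) by (simp add: basis_index_def)
  moreover have "z = z'"
    using arg_cong[OF assms(1), of "\<lambda>k. k mod W"] assms(4,5) by (simp add: basis_index_def)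
  moreover have "i = i'"
    using arg_cong[OF calculation(1), of "\<lambda>k. k div N"] assms(2,3) by simp
  ultimately show ?thesis by simp
qed

lemma mod_add_right_inject:
  fixes a y y' N :: nat
  assumes "(y + a) mod N = (y' + a) mod N" "y < N" "y' < N"
  shows "y = y'"
proof -
  obtain p q where "y + a + N * p = y' + a + N * q" using assms(1) nat_mod_eq_iff by blast
  then have "y mod N = y' mod N" using nat_mod_eq_iff[of y N y'] by auto
  then show ?thesis using assms by simp
qed

text \<open>Adding a fixed number modulo \<open>N\<close> is injective and the query register is
  untouched. This holds for every \<open>g\<close>, so the algorithm is norm preserving off the
  promise too.\<close>

lemma oracle_target_bij: "bij_betw (oracle_target N W g) {..<m * N * W} {..<m * N * W}"
proof -
  have "inj_on (oracle_target N W g) {..<m * N * W}"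
  proof (rule inj_onI)
    fix k k' assume k: "k \<in> {..<m * N * W}" "k' \<in> {..<m * N * W}"
      and eq: "oracle_target N W g k = oracle_target N W g k'"
    have pos: "N > 0" "W > 0" using k by (auto intro: gr0I)
    have i: "k div (N * W) = k' div (N * W)"
      and y: "(k div W mod N + g (k div (N * W))) mod N = (k' div W mod N + g (k' div (N * W))) mod N"
      and z: "k mod W = k' mod W"
      using basis_index_inject[OF eq[unfolded oracle_target_def]] pos by auto
    have "k div W mod N = k' div W mod N" using mod_add_right_inject[OF y[unfolded i]] pos by simp
    moreover have "k div W div N = k' div W div N"
      using i by (simp add: div_mult2_eq mult.commute[of N W])
    ultimately have "k div W = k' div W" by (metis div_mult_mod_eq)
    then show "k = k'" using z by (metis div_mult_mod_eq)
  qed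
  moreover have "oracle_target N W g ` {..<m * N * W} \<subseteq> {..<m * N * W}"
  proof (rule image_subsetI)
    fix k assume k: "k \<in> {..<m * N * W}"
    then have "N > 0" "W > 0" by (auto intro: gr0I)
    moreover have "k div (N * W) < m" using k by (auto intro: less_mult_imp_div_less simp: mult.assoc)
    ultimately show "oracle_target N W g k \<in> {..<m * N * W}"
      by (simp add: oracle_target_def basis_index_less)
  qed
  ultimately show ?thesis by (simp add: bij_betw_def endo_inj_surj)
qed

lemma query_oracle_norm:
  assumes "v \<in> carrier_vec (m * N * W)"
  shows "(\<Sum>k<m * N * W. (cmod ((query_oracle m N W g *\<^sub>v v) $ k))\<^sup>2) =
    (\<Sum>k<m * N * W. (cmod (v $ k))\<^sup>2)"
proof -
  let ?d = "m * N * W" and ?f = "oracle_target N W g"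
  have "(query_oracle m N W g *\<^sub>v v) $ ?f k = v $ k" if k: "k < ?d" for k
  proof -
    have f: "?f k < ?d" using bij_betwE[OF oracle_target_bij] k by blast
    have "(query_oracle m N W g *\<^sub>v v) $ ?f k = (\<Sum>j<?d. of_bool (?f k = ?f j) * v $ j)"
      unfolding mult_mat_vec_index_sum[OF query_oracle_carrier assms f]
      by (intro sum.cong refl) (simp add: query_oracle_index[OF f])
    also have "\<dots> = (\<Sum>j<?d. if k = j then v $ j else 0)"
      using k bij_betw_imp_inj_on[OF oracle_target_bij, of N W g m]
      by (intro sum.cong refl) (auto dest: inj_onD)
    finally show ?thesis using k by simp
  qed
  then have "(\<Sum>k<?d. (cmod (v $ k))\<^sup>2) =
      (\<Sum>k<?d. (cmod ((query_oracle m N W g *\<^sub>v v) $ ?f k))\<^sup>2)" by simp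
  also have "\<dots> = (\<Sum>k<?d. (cmod ((query_oracle m N W g *\<^sub>v v) $ k))\<^sup>2)"
    by (rule sum.reindex_bij_betw[OF oracle_target_bij])
  finally show ?thesis by simp
qed

lemma junta_sum_mult_mat_vec:
  fixes v :: "('x \<Rightarrow> 'y) \<Rightarrow> 'a::comm_ring_1 vec"
  assumes "\<And>g. A g \<in> carrier_mat d d" "\<And>g. v g \<in> carrier_vec d"
    and "\<And>i j. i < d \<Longrightarrow> j < d \<Longrightarrow> junta_sum X s (\<lambda>g. A g $$ (i, j))"
    and "\<And>j. j < d \<Longrightarrow> junta_sum X t (\<lambda>g. v g $ j)" and "i < d"
  shows "junta_sum X (s + t) (\<lambda>g. (A g *\<^sub>v v g) $ i)"
  unfolding mult_mat_vec_index_sum[OF assms(1,2,5)]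
proof (rule junta_sum_sum)
  fix j assume "j \<in> {..<d}"
  then have "j < d" by simp
  show "junta_sum X (s + t) (\<lambda>g. A g $$ (i, j) * v g $ j)"
    by (rule junta_sum_mult[OF assms(3)[OF \<open>i < d\<close> \<open>j < d\<close>] assms(4)[OF \<open>j < d\<close>]])
qed

section \<open>Amplitudes and acceptance probabilities as sums of juntas\<close>

text \<open>Gates have constant entries, and each oracle entry reads one value of \<open>g\<close>;
  so each query raises the number of values read by one.\<close>

lemma query_state_invariants:
  assumes "is_query_algorithm m N Q" "t \<le> queries Q"
  defines "d \<equiv> m * N * workspace Q"
  shows "(\<forall>g. query_state m N Q g t \<in> carrier_vec d \<and>
      (\<Sum>k<d. (cmod (query_state m N Q g t $ k))\<^sup>2) = 1) \<and>
    (\<forall>k<d. junta_sum {..<m} t (\<lambda>g. query_state m N Q g t $ k))"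
  using assms(2)
proof (induction t)
  case 0
  have Q: "start Q \<in> carrier_vec d" "(\<Sum>k<d. (cmod (start Q $ k))\<^sup>2) = 1"
    "unitary_matrix d (gate Q 0)"
    using assms(1) by (auto simp: is_query_algorithm_def d_def Let_def)
  then show ?case
    using unitary_matrix_norm[OF Q(3,1)] by (auto simp: unitary_matrix_def junta_sum_const)
next
  case (Suc t)
  let ?O = "query_oracle m N (workspace Q)" and ?s = "\<lambda>g. query_state m N Q g t"
  have IH: "\<And>g. ?s g \<in> carrier_vec d" "\<And>g. (\<Sum>k<d. (cmod (?s g $ k))\<^sup>2) = 1"
    "\<And>k. k < d \<Longrightarrow> junta_sum {..<m} t (\<lambda>g. ?s g $ k)"
    using Suc by auto
  have U: "unitary_matrix d (gate Q (Suc t))" "gate Q (Suc t) \<in> carrier_mat d d"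
    using assms(1) Suc.prems by (auto simp: is_query_algorithm_def d_def Let_def unitary_matrix_def)
  have O: "?O g \<in> carrier_mat d d" for g unfolding d_def by (rule query_oracle_carrier)
  have Os: "?O g *\<^sub>v ?s g \<in> carrier_vec d" for g using O IH(1) by (rule mult_mat_vec_carrier)
  have "(\<Sum>k<d. (cmod (query_state m N Q g (Suc t) $ k))\<^sup>2) = 1" for g
    using unitary_matrix_norm[OF U(1) Os] query_oracle_norm[OF IH(1)[unfolded d_def]] IH(2)
    by (simp add: d_def)
  moreover have "query_state m N Q g (Suc t) \<in> carrier_vec d" for g
    using U(2) Os by simp
  moreover have "junta_sum {..<m} (Suc t) (\<lambda>g. query_state m N Q g (Suc t) $ k)" if k: "k < d" for k
  proof -
    \<comment> \<open>Column \<open>j\<close> has a fixed query register, the only point at which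
      its entries consult \<open>g\<close>.\<close>
    have "junta_sum {..<m} 1 (\<lambda>g. ?O g $$ (i, j))" if ij: "i < d" "j < d" for i j
    proof (rule junta_sum.junta[of "{j div (N * workspace Q)}"])
      show "{j div (N * workspace Q)} \<subseteq> {..<m}"
        using ij by (auto simp: d_def mult.assoc intro: less_mult_imp_div_less)
    qed (use ij in \<open>auto simp: d_def query_oracle_index oracle_target_def\<close>)
    then have "junta_sum {..<m} (1 + t) (\<lambda>g. (?O g *\<^sub>v ?s g) $ j)" if "j < d" for j
      using IH O that by (intro junta_sum_mult_mat_vec)
    then have "junta_sum {..<m} (0 + (1 + t)) (\<lambda>g. (gate Q (Suc t) *\<^sub>v (?O g *\<^sub>v ?s g)) $ k)"
      using U(2) Os k by (intro junta_sum_mult_mat_vec[where A = "\<lambda>_. gate Q (Suc t)"] junta_sum_const)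
    then show ?thesis by simp
  qed
  ultimately show ?case by blast
qed

text \<open>A squared modulus is the sum of the squares of real and imaginary part, and squaring
  doubles the number of values read.\<close>

lemma output_prob_junta_sum:
  assumes "is_query_algorithm m N Q"
  shows "junta_sum {..<m} (2 * queries Q) (\<lambda>g. output_prob m N Q g v)"
proof -
  let ?s = "\<lambda>g. query_state m N Q g (queries Q)" and ?T = "queries Q"
  have "junta_sum {..<m} (?T + ?T) (\<lambda>g. Re (?s g $ k) * Re (?s g $ k) + Im (?s g $ k) * Im (?s g $ k))"
    if "k < m * N * workspace Q" for k
  proof -
    have "junta_sum {..<m} ?T (\<lambda>g. ?s g $ k)"
      using query_state_invariants[OF assms order_refl] that by blast
    then show ?thesis
      by (intro junta_sum.add junta_sum_mult junta_sum_additive_map[where \<phi> = Re]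
          junta_sum_additive_map[where \<phi> = Im]) simp_all
  qed
  moreover have "(cmod z)\<^sup>2 = Re z * Re z + Im z * Im z" for z
    using cmod_power2[of z] by (simp only: power2_eq_square)
  ultimately have "junta_sum {..<m} (2 * ?T) (\<lambda>g. (cmod (?s g $ k))\<^sup>2)"
    if "k < m * N * workspace Q" for k
    using that by (simp only: mult_2)
  then show ?thesis unfolding output_prob_def by (intro junta_sum_sum) simp
qed

lemma output_prob_complement:
  assumes "is_query_algorithm m N Q"
  shows "output_prob m N Q g True + output_prob m N Q g False = 1"
proof -
  let ?d = "m * N * workspace Q"
  let ?p = "\<lambda>k. (cmod (query_state m N Q g (queries Q) $ k))\<^sup>2"
  have "output_prob m N Q g True + output_prob m N Q g False =
      sum ?p ({k. k < ?d \<and> verdict Q k = True} \<union> {k. k < ?d \<and> verdict Q k = False})"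
    unfolding output_prob_def by (rule sum.union_disjoint[symmetric]) auto
  also have "{k. k < ?d \<and> verdict Q k = True} \<union> {k. k < ?d \<and> verdict Q k = False} = {..<?d}"
    by auto
  also have "sum ?p {..<?d} = 1"
    using query_state_invariants[OF assms order_refl] by blast
  finally show ?thesis .
qed

lemma output_prob_nonneg: "output_prob m N Q g v \<ge> 0"
  unfolding output_prob_def by (intro sum_nonneg) simp

section \<open>The two ends of the comparison and the final bound\<close>

text \<open>Both \<open>\<tau>\<close> and \<open>\<tau>'\<close> map \<open>{..<n}\<close> onto
  itself, so both halves have as image that of \<open>{..<n}\<close> under \<open>\<sigma>\<close>,
  shifted by 1.\<close>

lemma solves_set_equality_equal:
  assumes "solves_set_equality n N Q" "2 * n \<le> N" "\<sigma> permutes {..<n + n}"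
    "\<tau> permutes {..<n}" "\<tau>' permutes {..<n}"
  shows "output_prob (2 * n) N Q (\<lambda>x. Suc ((\<sigma> \<circ> glue n \<tau> \<tau>') x)) True \<ge> 2 / 3"
proof -
  \<comment> \<open>Domain and values are counted from 0 here and from 1 in the promise, hence
    \<open>i - 1\<close> and \<open>Suc\<close>.\<close>
  define lift where "lift \<rho> i = Suc (\<sigma> (\<rho> (i - 1)))" for \<rho> :: "nat \<Rightarrow> nat" and i
  have props: "lift \<rho> \<in> {1..n} \<rightarrow> {1..N} \<and> inj_on (lift \<rho>) {1..n} \<and> lift \<rho> ` {1..n} = (\<lambda>x. Suc (\<sigma> x)) ` {..<n}"
    if \<rho>: "\<rho> permutes {..<n}" for \<rho>
  proof (intro conjI)
    have pred: "(\<lambda>i. i - 1) ` {1..n} = {..<n}"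
      by (auto simp: image_iff intro!: bexI[of _ "Suc _"])
    have "lift \<rho> ` {1..n} = (\<lambda>x. Suc (\<sigma> x)) ` \<rho> ` (\<lambda>i. i - 1) ` {1..n}"
      by (simp add: image_image lift_def)
    then show im: "lift \<rho> ` {1..n} = (\<lambda>x. Suc (\<sigma> x)) ` {..<n}"
      unfolding pred permutes_image[OF \<rho>] .
    have "\<sigma> x < n + n" if "x < n" for x
      using permutes_in_image[OF assms(3), of x] that by simp
    then have "lift \<rho> ` {1..n} \<subseteq> {1..N}" unfolding im using assms(2) by fastforce
    then show "lift \<rho> \<in> {1..n} \<rightarrow> {1..N}" by blast
    show "inj_on (lift \<rho>) {1..n}"
      by (rule inj_onI) (auto simp: lift_def inj_eq[OF permutes_inj[OF assms(3)]] inj_eq[OF permutes_inj[OF \<rho>]])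
  qed
  have "set_equality_promise n N (lift \<tau>) (lift \<tau>')" "lift \<tau> ` {1..n} = lift \<tau>' ` {1..n}"
    using props[OF assms(4)] props[OF assms(5)] by (auto simp: set_equality_promise_def)
  then have "output_prob (2 * n) N Q (combined_input n (lift \<tau>) (lift \<tau>')) True \<ge> 2 / 3"
    using assms(1)[unfolded solves_set_equality_def, rule_format, of "lift \<tau>" "lift \<tau>'"] by simp
  also have "combined_input n (lift \<tau>) (lift \<tau>') = (\<lambda>x. Suc ((\<sigma> \<circ> glue n \<tau> \<tau>') x))"
    by (auto simp: combined_input_def lift_def)
  finally show ?thesis .
qed

lemma solves_set_equality_disjoint:
  assumes "solves_set_equality n N Q" "2 * n \<le> N" "1 \<le> n" "\<sigma> permutes {..<n + n}"
  shows "output_prob (2 * n) N Q (\<lambda>x. Suc (\<sigma> x)) False \<ge> 2 / 3"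
proof -
  define a where "a i = Suc (\<sigma> (i - 1))" for i
  define b where "b i = Suc (\<sigma> (i - 1 + n))" for i
  have "\<sigma> x < N" if "x < n + n" for x
    using permutes_in_image[OF assms(4), of x] that assms(2) by simp
  then have "a \<in> {1..n} \<rightarrow> {1..N}" "b \<in> {1..n} \<rightarrow> {1..N}"
    by (auto simp: a_def b_def Suc_le_eq)
  moreover have "inj_on a {1..n}" "inj_on b {1..n}" and disj: "a ` {1..n} \<inter> b ` {1..n} = {}"
    by (auto intro!: inj_onI simp: a_def b_def inj_eq[OF permutes_inj[OF assms(4)]])
  ultimately have "set_equality_promise n N a b" by (simp add: set_equality_promise_def)
  \<comment> \<open>For \<open>n \<ge> 1\<close> the images are nonempty, so disjoint images
    differ.\<close>
  moreover have "a ` {1..n} \<noteq> b ` {1..n}" using disj assms(3) by auto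
  ultimately have "output_prob (2 * n) N Q (combined_input n a b) False \<ge> 2 / 3"
    using assms(1)[unfolded solves_set_equality_def, rule_format, of a b] by simp
  also have "combined_input n a b = (\<lambda>x. Suc (\<sigma> x))"
    by (auto simp: combined_input_def a_def b_def)
  finally show ?thesis .
qed

text \<open>The averages compared in \<open>disjoint_vs_equal_images\<close> are at most 1/3 and at
  least 2/3, while \<open>d\<close> is twice the number of queries; 4608 is 3 * 48 * 2^5.\<close>

lemma set_equality_query_bound:
  assumes "1 \<le> n" "2 * n \<le> N" "is_query_algorithm (2 * n) N Q" "solves_set_equality n N Q"
  shows "real n \<le> 4608 * real (queries Q) ^ 5"
proof -
  define F where "F g = output_prob (2 * n) N Q (\<lambda>x. Suc (g x)) True" for g
  let ?P = "{\<sigma>. \<sigma> permutes {..<n + n}}" and ?R = "{\<tau>. \<tau> permutes {..<n}}"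
  have F_False: "F g = 1 - output_prob (2 * n) N Q (\<lambda>x. Suc (g x)) False" for g
    using output_prob_complement[OF assms(3), of "\<lambda>x. Suc (g x)"] by (simp add: F_def)
  have "junta_sum {..<n + n} (2 * queries Q) F"
    using junta_sum_substitute[OF output_prob_junta_sum[OF assms(3), of True], of id "{..<n + n}" "\<lambda>_. Suc"]
    by (simp add: F_def[abs_def] mult_2)
  moreover have "F g \<in> {0..1}" for g
    using F_False[of g] output_prob_nonneg[of "2 * n" N Q "\<lambda>x. Suc (g x)" True]
      output_prob_nonneg[of "2 * n" N Q "\<lambda>x. Suc (g x)" False] by (simp add: F_def)
  ultimately have "\<bar>avg ?P F - avg ?P (\<lambda>\<sigma>. avg ?R (\<lambda>\<tau>. avg ?R (\<lambda>\<tau>'. F (\<sigma> \<circ> glue n \<tau> \<tau>'))))\<bar> \<le>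
      48 * real (2 * queries Q) ^ 5 / real n"
    using assms(1) by (rule disjoint_vs_equal_images)
  moreover have "avg ?P F \<le> avg ?P (\<lambda>_. 1 / 3)"
  proof (rule avg_mono)
    fix \<sigma> assume "\<sigma> \<in> ?P"
    then show "F \<sigma> \<le> 1 / 3"
      using solves_set_equality_disjoint[OF assms(4,2,1)] by (simp add: F_False field_simps)
  qed
  moreover have "avg ?P (\<lambda>_. avg ?R (\<lambda>_. avg ?R (\<lambda>_. 2 / 3))) \<le>
      avg ?P (\<lambda>\<sigma>. avg ?R (\<lambda>\<tau>. avg ?R (\<lambda>\<tau>'. F (\<sigma> \<circ> glue n \<tau> \<tau>'))))"
    unfolding F_def by (intro avg_mono solves_set_equality_equal assms) simp_all
  ultimately have "1 / 3 \<le> 48 * real (2 * queries Q) ^ 5 / real n"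
    by (simp only: avg_const[OF finite_nonempty_permutes])
  then show ?thesis using assms(1) by (simp add: field_simps)
qed

theorem theorem3:
  shows "\<exists>c::real. c > 0 \<and>
    (\<forall>(n::nat) (N::nat) (Q::query_algorithm).
       n \<ge> 2 \<longrightarrow> N \<ge> 2 * n \<longrightarrow>
       is_query_algorithm (2 * n) N Q \<longrightarrow> solves_set_equality n N Q \<longrightarrow>
       real (queries Q) \<ge> c * root 5 (real n / ln (real n)))"
proof (intro exI[of _ "1 / 10"] conjI allI impI)
  fix n N :: nat and Q :: query_algorithm
  assume n: "n \<ge> 2" and *: "N \<ge> 2 * n" "is_query_algorithm (2 * n) N Q" "solves_set_equality n N Q"
  \<comment> \<open>The logarithm is bounded below by 1/2, so \<open>n / ln n\<close> is at most
    \<open>2 * n\<close>.\<close>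
  have "1 - 1 / real n \<le> ln (real n)" using ln_le_minus_one[of "1 / real n"] n by (simp add: ln_div)
  moreover have "1 / real n \<le> 1 / 2" using n by (simp add: field_simps)
  ultimately have ln: "1 / 2 \<le> ln (real n)" by linarith
  then have "real n / ln (real n) \<le> real n / (1 / 2)" by (intro divide_left_mono) auto
  \<comment> \<open>The constant 1/10 works because 2 * 4608 is at most 10^5.\<close>
  also have "\<dots> \<le> (10 * real (queries Q)) ^ 5"
    using set_equality_query_bound[OF _ *] n by (simp add: power_mult_distrib)
  finally have "root 5 (real n / ln (real n)) \<le> root 5 ((10 * real (queries Q)) ^ 5)"
    by (intro real_root_le_mono) auto
  also have "root 5 ((10 * real (queries Q)) ^ 5) = 10 * real (queries Q)"
    by (rule real_root_power_cancel) auto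
  finally show "1 / 10 * root 5 (real n / ln (real n)) \<le> real (queries Q)" by simp
qed simp

end
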